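(* Let $n\ge 4$ and let $(V,[\,\cdot,\dots,\cdot\,],\langle\cdot,\cdot\rangle)$ be a finite-dimensional indecomposable lorentzian metric Lie $n$-algebra. Then exactly one of the following holds: (i) $V$ is one-dimensional; (ii) $V$ is simple; (iii) $V=\mathbb{R}u\oplus\mathbb{R}v\oplus W$ as a vector space, where $\langle u,u\rangle=\langle v,v\rangle=0$, $\langle u,v\rangle=1$, $u,v\perp W$, and the restriction of $\langle\cdot,\cdot\rangle$ to $W$ is positive definite. In this case there is an alternating $(n-1)$-linear bracket $[x_1,\dots,x_{n-1}]$ on $W$ such that the only nonzero $n$-brackets of $V$ are those obtained by skew-symmetry from $$[u,x_1,\dots,x_{n-1}]=[x_1,\dots,x_{n-1}],\qquad [x_1,\dots,x_n]=(-1)^n\langle [x_1,\dots,x_{n-1}],x_n\rangle\, v,$$ for $x_i\in W$ (in particular every bracket containing $v$, or containing $u$ twice, vanishes). Moreover, this $(n-1)$-bracket makes $W$ (with the restricted inner product) into a euclidean metric Lie $(n-1)$-algebra isomorphic to an orthogonal direct sum of $m$ copies of the simple euclidean Lie $(n-1)$-algebra $\mathfrak{s}^{(n-1)}$, for some integer $m\ge 1$. In particular $\dim V=mn+2$.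
   Context: All vector spaces are real and finite-dimensional. For $k\ge 2$, a Lie $k$-algebra is a vector space $V$ with an alternating $k$-linear map $[\cdot,\dots,\cdot]:\Lambda^kV\to V$ such that for all $x_1,\dots,x_{k-1}\in V$ the map $\mathrm{ad}_{x_1,\dots,x_{k-1}}:y\mapsto[x_1,\dots,x_{k-1},y]$ is a derivation of the bracket (for $k=2$ this is a Lie algebra). An ideal is a subspace $I$ with $[I,V,\dots,V]\subset I$. A Lie $k$-algebra is simple if it is not one-dimensional and its only ideals are $0$ and $V$. A metric Lie $k$-algebra is a Lie $k$-algebra with a nondegenerate symmetric bilinear form $\langle\cdot,\cdot\rangle$ such that every $\mathrm{ad}_{x_1,\dots,x_{k-1}}$ is skew-symmetric. It is euclidean if the form is positive definite, and lorentzian if the form has exactly one negative eigenvalue (signature $(1,\dim V-1)$, one timelike direction). A metric Lie $k$-algebra is indecomposable if it has no nondegenerate ideal other than $0$ and $V$ (equivalently, it is not an orthogonal direct sum of two nonzero ideals). Isomorphism of metric Lie $k$-algebras means a linear isometry preserving brackets. For $k\ge 3$, $\mathfrak{s}^{(k)}$ denotes the $(k+1)$-dimensional Lie $k$-algebra with basis $\boldsymbol e_1,\dots,\boldsymbol e_{k+1}$ and bracket $[\boldsymbol e_1,\dots,\widehat{\boldsymbol e_i},\dots,\boldsymbol e_{k+1}]=(-1)^i\boldsymbol e_i$ (hat denotes omission), equipped with an inner product for which this basis is orthogonal with all $\langle\boldsymbol e_i,\boldsymbol e_i\rangle$ equal to the same positive number; this is the simple euclidean Lie $k$-algebra (unique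 up to the scale of the inner product). *)

theory Defs
  imports "HOL-Analysis.Analysis"
begin

text \<open>A k-ary bracket on a carrier subspace S of a real vector space is modelled as a
function on lists; only its values on lists of length k with entries in S matter.\<close>

definition closed_on :: "'v::real_vector set \<Rightarrow> nat \<Rightarrow> ('v list \<Rightarrow> 'v) \<Rightarrow> bool" where
  "closed_on S k br \<longleftrightarrow> (\<forall>xs. length xs = k \<and> set xs \<subseteq> S \<longrightarrow> br xs \<in> S)"

definition multilinear_on :: "'v::real_vector set \<Rightarrow> nat \<Rightarrow> ('v list \<Rightarrow> 'w::real_vector) \<Rightarrow> bool" where
  "multilinear_on S k br \<longleftrightarrow>
     (\<forall>xs i x y a b. length xs = k \<and> set xs \<subseteq> S \<and> i < k \<and> x \<in> S \<and> y \<in> S \<longrightarrow>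
        br (xs[i := a *\<^sub>R x + b *\<^sub>R y]) = a *\<^sub>R br (xs[i := x]) + b *\<^sub>R br (xs[i := y]))"

definition alternating_on :: "'v::real_vector set \<Rightarrow> nat \<Rightarrow> ('v list \<Rightarrow> 'w::real_vector) \<Rightarrow> bool" where
  "alternating_on S k br \<longleftrightarrow>
     (\<forall>xs. length xs = k \<and> set xs \<subseteq> S \<and> \<not> distinct xs \<longrightarrow> br xs = 0)"

definition lie_k_algebra :: "'v::real_vector set \<Rightarrow> nat \<Rightarrow> ('v list \<Rightarrow> 'v) \<Rightarrow> bool" where
  "lie_k_algebra S k br \<longleftrightarrow> subspace S \<and> 2 \<le> k \<and> closed_on S k br \<and>
     multilinear_on S k br \<and> alternating_on S k br \<and>
     (\<forall>xs ys. length xs = k - 1 \<and> set xs \<subseteq> S \<and> length ys = k \<and> set ys \<subseteq> S \<longrightarrow>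
        br (xs @ [br ys]) = (\<Sum>i<k. br (ys[i := br (xs @ [ys ! i])])))"

definition ideal_of :: "'v::real_vector set \<Rightarrow> nat \<Rightarrow> ('v list \<Rightarrow> 'v) \<Rightarrow> 'v set \<Rightarrow> bool" where
  "ideal_of S k br I \<longleftrightarrow> subspace I \<and> I \<subseteq> S \<and>
     (\<forall>x\<in>I. \<forall>ys. length ys = k - 1 \<and> set ys \<subseteq> S \<longrightarrow> br (x # ys) \<in> I)"

definition simple_lie_k :: "'v::real_vector set \<Rightarrow> nat \<Rightarrow> ('v list \<Rightarrow> 'v) \<Rightarrow> bool" where
  "simple_lie_k S k br \<longleftrightarrow> lie_k_algebra S k br \<and> dim S \<noteq> 1 \<and>
     (\<forall>I. ideal_of S k br I \<longrightarrow> I = {0} \<or> I = S)"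

definition nondegenerate_on :: "'v::real_vector set \<Rightarrow> ('v \<Rightarrow> 'v \<Rightarrow> real) \<Rightarrow> bool" where
  "nondegenerate_on S B \<longleftrightarrow> (\<forall>x\<in>S. (\<forall>y\<in>S. B x y = 0) \<longrightarrow> x = 0)"

definition sym_bilinear_on :: "'v::real_vector set \<Rightarrow> ('v \<Rightarrow> 'v \<Rightarrow> real) \<Rightarrow> bool" where
  "sym_bilinear_on S B \<longleftrightarrow> (\<forall>x\<in>S. \<forall>y\<in>S. B x y = B y x) \<and>
     (\<forall>x\<in>S. \<forall>y\<in>S. \<forall>z\<in>S. \<forall>a b. B (a *\<^sub>R x + b *\<^sub>R y) z = a * B x z + b * B y z)"

definition metric_lie_k :: "'v::real_vector set \<Rightarrow> nat \<Rightarrow> ('v list \<Rightarrow> 'v) \<Rightarrow> ('v \<Rightarrow> 'v \<Rightarrow> real) \<Rightarrow> bool" where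
  "metric_lie_k S k br B \<longleftrightarrow> lie_k_algebra S k br \<and> sym_bilinear_on S B \<and> nondegenerate_on S B \<and>
     (\<forall>xs y z. length xs = k - 1 \<and> set xs \<subseteq> S \<and> y \<in> S \<and> z \<in> S \<longrightarrow>
        B (br (xs @ [y])) z = - B y (br (xs @ [z])))"

definition euclidean_form_on :: "'v::real_vector set \<Rightarrow> ('v \<Rightarrow> 'v \<Rightarrow> real) \<Rightarrow> bool" where
  "euclidean_form_on S B \<longleftrightarrow> (\<forall>x\<in>S. x \<noteq> 0 \<longrightarrow> 0 < B x x)"

definition lorentzian_form_on :: "'v::real_vector set \<Rightarrow> ('v \<Rightarrow> 'v \<Rightarrow> real) \<Rightarrow> bool" where
  "lorentzian_form_on S B \<longleftrightarrow>
     (\<exists>E. finite E \<and> E \<subseteq> S \<and> independent E \<and> span E = S \<and>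
          (\<forall>x\<in>E. \<forall>y\<in>E. x \<noteq> y \<longrightarrow> B x y = 0) \<and>
          card {x\<in>E. B x x < 0} = 1 \<and> (\<forall>x\<in>E. B x x \<noteq> 0))"

definition indecomposable_metric :: "'v::real_vector set \<Rightarrow> nat \<Rightarrow> ('v list \<Rightarrow> 'v) \<Rightarrow> ('v \<Rightarrow> 'v \<Rightarrow> real) \<Rightarrow> bool" where
  "indecomposable_metric S k br B \<longleftrightarrow> metric_lie_k S k br B \<and>
     (\<forall>I. ideal_of S k br I \<and> nondegenerate_on I B \<longrightarrow> I = {0} \<or> I = S)"

text \<open>(S, br, B) (a metric Lie k-algebra) is isometrically isomorphic to the orthogonal direct
sum of m copies of the simple euclidean Lie k-algebra s^(k) (copy j carrying the scale c j > 0).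
The isomorphism is given by the images e j i in S of the standard basis vectors e_i
(i = 1..k+1) of the j-th copy: these form a basis of S, have the Gram matrix of the model,
and satisfy the model's brackets [e_1,..,e_i omitted,..,e_{k+1}] = (-1)^i e_i within a copy,
while brackets of basis vectors from different copies vanish (all other brackets of basis
vectors are then fixed by alternation, as in the model).\<close>
definition iso_sum_simple :: "'v::real_vector set \<Rightarrow> nat \<Rightarrow> ('v list \<Rightarrow> 'v) \<Rightarrow> ('v \<Rightarrow> 'v \<Rightarrow> real) \<Rightarrow> nat \<Rightarrow> bool" where
  "iso_sum_simple S k br B m \<longleftrightarrow>
     (\<exists>(e :: nat \<Rightarrow> nat \<Rightarrow> 'v) (c :: nat \<Rightarrow> real).
        let Idx = {..<m} \<times> {1..k+1}; E = (\<lambda>(j, i). e j i) ` Idx in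
        inj_on (\<lambda>(j, i). e j i) Idx \<and> E \<subseteq> S \<and> independent E \<and> span E = S \<and>
        (\<forall>j<m. 0 < c j) \<and>
        (\<forall>p\<in>Idx. \<forall>q\<in>Idx. B (case_prod e p) (case_prod e q) = (if p = q then c (fst p) else 0)) \<and>
        (\<forall>j<m. \<forall>i\<in>{1..k+1}.
            br (map (e j) ([1..<i] @ [Suc i..<k+2])) = (-1) ^ i *\<^sub>R e j i) \<and>
        (\<forall>ps. length ps = k \<and> set ps \<subseteq> Idx \<and> (\<exists>p\<in>set ps. \<exists>q\<in>set ps. fst p \<noteq> fst q) \<longrightarrow>
            br (map (case_prod e) ps) = 0))"

end

theory Submission
  imports Defs
begin

text \<open>
  Write \<open>F (x\<^sub>0, \<dots>, x\<^sub>k) = B [x\<^sub>0, \<dots>, x\<^bsub>k-1\<^esub>] x\<^sub>k\<close> for the alternating form of a metric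
  Lie k-algebra.  In the euclidean case with \<open>k \<ge> 3\<close>, let \<open>s\<^sub>0, \<dots>, s\<^sub>k\<close> be unit vectors at which
  F is maximal.  The first-order conditions make them orthonormal and their span closed
  under the bracket.  Freezing k - 3 of them reduces the claim that \<open>ad\<close> of any k - 1 of them kills
  the orthogonal complement to a Lie 3-algebra: there the six operators \<open>ad\<close> form a
  representation of so(4) on the complement in which, by maximality, every weight is strictly
  smaller than in the vector representation, while the fundamental identity forces both
  su(2) factors to act with the same spin; together these leave only the trivial representation.
  Since derivations preserve brackets, the span is then an ideal of type \<open>s\<^bsup>(k)\<^esup>\<close>, and one splits
  it off and continues.

  A lorentzian algebra that is neither simple nor one-dimensional has a degenerate ideal, whose
  radical is a null line \<open>\<real>v\<close>, and skew-symmetry makes v central.  With a dual null vector u and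
  \<open>W = {u, v}\<^sup>\<bottom>\<close>, the bracket \<open>[u, \<dots>]\<close> is a euclidean Lie (n-1)-algebra on W, and the projection of
  the n-bracket to W is a euclidean Lie n-algebra.  A simple summand of the latter would lift to a
  nondegenerate ideal, so it vanishes; a central vector of the former would be central in the
  whole algebra, so only simple summands remain.
\<close>

section \<open>Positive definite subspaces\<close>

text \<open>The first-order condition for a maximum at r = 0, in a form that replaces derivatives in
  the variational arguments below.\<close>

lemma linear_coeff_zero:
  fixes p q :: real
  assumes "\<And>r. 2 * r * p + r\<^sup>2 * q \<le> 0"
  shows "p = 0"
proof -
  define d where "d = 1 + \<bar>q\<bar>"
  have d: "d > 0" "2 * d + q > 0" by (auto simp: d_def)
  have "d\<^sup>2 * (2 * (p / d) * p + (p / d)\<^sup>2 * q) \<le> 0"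
    using assms[of "p / d"] by (simp add: mult_nonneg_nonpos)
  also have "d\<^sup>2 * (2 * (p / d) * p + (p / d)\<^sup>2 * q) = p\<^sup>2 * (2 * d + q)"
    using d by (simp add: field_simps power2_eq_square)
  finally have "p\<^sup>2 \<le> 0" using d by (simp add: mult_le_0_iff)
  then show ?thesis by simp
qed

lemma eq_uminus_self: "x = - x \<Longrightarrow> x = (0::'a::real_vector)"
proof -
  assume "x = - x"
  then have "2 *\<^sub>R x = 0" by (metis add.right_inverse scaleR_2)
  then show ?thesis by simp
qed

text \<open>\<open>B\<close> is bilinear on the whole type and positive only on \<open>M\<close>.
  The instance \<open>M = {0}\<close> therefore provides the same calculus for an indefinite
  form.\<close>

locale euclidean_subspace =
  fixes M :: "'v::euclidean_space set" and B :: "'v \<Rightarrow> 'v \<Rightarrow> real"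
  assumes sub: "subspace M"
    and B_sym: "B x y = B y x"
    and B_add: "B (x + y) z = B x z + B y z"
    and B_scale: "B (r *\<^sub>R x) z = r * B x z"
    and B_pos: "x \<in> M \<Longrightarrow> x \<noteq> 0 \<Longrightarrow> 0 < B x x"
begin

lemma B_add2: "B z (x + y) = B z x + B z y" by (simp only: B_sym[of z] B_add)
lemma B_scale2: "B z (r *\<^sub>R x) = r * B z x" by (simp only: B_sym[of z] B_scale)
lemma B_zero: "B 0 x = 0" "B x 0 = 0" using B_scale[of 0] B_scale2[of _ 0] by auto
lemma B_minus: "B (- x) y = - B x y" "B x (- y) = - B x y"
  using B_scale[of "-1"] B_scale2[of _ "-1"] by auto
lemma B_diff: "B (x - y) z = B x z - B y z" "B z (x - y) = B z x - B z y"
  using B_add[of x "-y"] B_add2[of z x "-y"] by (auto simp: B_minus)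

lemmas B_simps = B_add B_add2 B_scale B_scale2 B_zero B_minus B_diff

lemma M_closed [simp, intro]: "0 \<in> M" "x \<in> M \<Longrightarrow> y \<in> M \<Longrightarrow> x + y \<in> M" "x \<in> M \<Longrightarrow> y \<in> M \<Longrightarrow> x - y \<in> M"
  "x \<in> M \<Longrightarrow> r *\<^sub>R x \<in> M" "x \<in> M \<Longrightarrow> - x \<in> M"
  using sub by (auto simp: subspace_0 subspace_add subspace_diff subspace_scale subspace_neg)

lemma B_nonneg: "x \<in> M \<Longrightarrow> 0 \<le> B x x"
  by (cases "x = 0") (auto simp: B_zero dest: B_pos)

lemma B_eq_0_iff: "x \<in> M \<Longrightarrow> B x x = 0 \<longleftrightarrow> x = 0"
  by (cases "x = 0") (auto simp: B_zero dest: B_pos)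

lemma eq_by_B: "x \<in> M \<Longrightarrow> y \<in> M \<Longrightarrow> (\<And>z. z \<in> M \<Longrightarrow> B x z = B y z) \<Longrightarrow> x = y"
  using B_eq_0_iff[of "x - y"] by (auto simp: B_simps)

text \<open>\<open>B\<close> is compared with the norm of the type: its minimum m on the norm-unit
  sphere of N is positive, so a vector with \<open>B x x = 1\<close> has norm at most
  \<open>1 / sqrt m\<close>.\<close>

lemma compact_unit_sphere:
  assumes N: "subspace N" "N \<subseteq> M"
  shows "compact {x \<in> N. B x x = 1}"
proof -
  have "bilinear B"
    by (auto simp: bilinear_def B_simps intro!: linearI)
  then have bb: "bounded_bilinear B" by (simp add: bilinear_conv_bounded_bilinear)
  have cont: "continuous_on A (\<lambda>x. B x x)" for A
    by (rule bounded_bilinear.continuous_on[OF bb continuous_on_id continuous_on_id])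
  have clN: "closed N" using N(1) by (rule closed_subspace)
  have "\<exists>m>0. \<forall>x\<in>N. norm x = 1 \<longrightarrow> m \<le> B x x"
  proof (cases "N \<inter> sphere 0 1 = {}")
    case True
    then show ?thesis by (intro exI[of _ 1]) auto
  next
    case False
    have "compact (N \<inter> sphere 0 1)" using clN by (intro closed_Int_compact) auto
    from continuous_attains_inf[OF this False cont] obtain y where
      y: "y \<in> N" "norm y = 1" "\<And>x. x \<in> N \<Longrightarrow> norm x = 1 \<Longrightarrow> B y y \<le> B x x" by auto
    have "B y y > 0" using y N by (intro B_pos) auto
    then show ?thesis using y by blast
  qed
  then obtain m where m: "m > 0" "\<And>x. x \<in> N \<Longrightarrow> norm x = 1 \<Longrightarrow> m \<le> B x x" by blast
  have "norm x \<le> 1 / sqrt m" if x: "x \<in> N" "B x x = 1" for x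
  proof -
    have "x \<noteq> 0" using x by (auto simp: B_zero)
    then have "m \<le> B ((1 / norm x) *\<^sub>R x) ((1 / norm x) *\<^sub>R x)"
      using x N(1) by (intro m) (auto intro: subspace_scale)
    also have "\<dots> = 1 / (norm x)\<^sup>2" using x by (simp add: B_simps power2_eq_square)
    finally have "(norm x)\<^sup>2 \<le> 1 / m" using \<open>x \<noteq> 0\<close> m by (simp add: field_simps)
    then have "norm x \<le> sqrt (1 / m)" by (rule real_le_rsqrt)
    then show ?thesis by (simp add: real_sqrt_divide)
  qed
  then have "bounded {x \<in> N. B x x = 1}" by (auto simp: bounded_iff)
  moreover have "closed {x \<in> N. B x x = 1}"
  proof -
    have "closed (N \<inter> (\<lambda>x. B x x) -` {1})"
      by (rule continuous_closed_preimage[OF cont clN]) auto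
    moreover have "N \<inter> (\<lambda>x. B x x) -` {1} = {x \<in> N. B x x = 1}" by auto
    ultimately show ?thesis by simp
  qed
  ultimately show ?thesis by (simp add: compact_eq_bounded_closed)
qed

lemma normalise:
  assumes "x \<in> N" "x \<noteq> 0" "subspace N" "N \<subseteq> M"
  obtains s where "s > 0" "s *\<^sub>R x \<in> N" "B (s *\<^sub>R x) (s *\<^sub>R x) = 1" "s * s * B x x = 1"
proof
  have "B x x > 0" using assms B_pos by auto
  then show "1 / sqrt (B x x) > 0" "1 / sqrt (B x x) * (1 / sqrt (B x x)) * B x x = 1"
    "B ((1 / sqrt (B x x)) *\<^sub>R x) ((1 / sqrt (B x x)) *\<^sub>R x) = 1" by (auto simp: B_simps)
  show "(1 / sqrt (B x x)) *\<^sub>R x \<in> N" using assms by (auto intro: subspace_scale)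
qed

text \<open>Compactness of the unit sphere yields a maximum of \<open>B (a x) (a x)\<close>; both
  sides being quadratic, the bound extends from unit vectors to N.\<close>

lemma top_vector:
  assumes N: "subspace N" "N \<subseteq> M" "y \<in> N" "y \<noteq> 0" and a: "linear a"
  obtains g where "g \<in> N" "B g g = 1" "\<And>x. x \<in> N \<Longrightarrow> B (a x) (a x) \<le> B (a g) (a g) * B x x"
proof -
  obtain s where "s > 0" "s *\<^sub>R y \<in> N" "B (s *\<^sub>R y) (s *\<^sub>R y) = 1"
    using normalise[OF N(3,4,1,2)] by metis
  then have ne: "{x \<in> N. B x x = 1} \<noteq> {}" by auto
  have "bilinear B"
    by (auto simp: bilinear_def B_simps intro!: linearI)
  then have bb: "bounded_bilinear B" by (simp add: bilinear_conv_bounded_bilinear)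
  have cont: "continuous_on A (\<lambda>x. B (a x) (a x))" for A
    using a linear_continuous_on[of a A] 
    by (intro bounded_bilinear.continuous_on[OF bb]) (auto simp: linear_conv_bounded_linear)
  from continuous_attains_sup[OF compact_unit_sphere[OF N(1,2)] ne cont] obtain g where
    g: "g \<in> N" "B g g = 1" "\<And>x. x \<in> N \<Longrightarrow> B x x = 1 \<Longrightarrow> B (a x) (a x) \<le> B (a g) (a g)" by auto
  show ?thesis
  proof (rule that[OF g(1,2)])
    fix x assume x: "x \<in> N"
    show "B (a x) (a x) \<le> B (a g) (a g) * B x x"
    proof (cases "x = 0")
      case True
      then show ?thesis using linear_0[OF a] by (simp add: B_zero)
    next
      case False
      then obtain s where s: "s > 0" "s *\<^sub>R x \<in> N" "B (s *\<^sub>R x) (s *\<^sub>R x) = 1" "s * s * B x x = 1"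
        using normalise[OF x _ N(1,2)] by metis
      have "s * s * B (a x) (a x) \<le> B (a g) (a g)"
        using g(3)[OF s(2,3)] linear_scale[OF a] by (simp add: B_simps)
      then have "s * s * B (a x) (a x) \<le> s * s * (B (a g) (a g) * B x x)"
        using s(4) by (simp add: algebra_simps) (metis mult.assoc mult.commute mult_1)
      then show ?thesis using s(1) by simp
    qed
  qed
qed

text \<open>On M the function \<open>(\<phi> y)\<^sup>2 - K * B y y\<close> attains its maximum 0 at
  x, so its derivative there in direction y vanishes. This turns an extremal value of a form into
  the vector representing it.\<close>

lemma extremal_functional:
  assumes lin: "\<And>x y r. \<phi> (x + r *\<^sub>R y) = \<phi> x + r * \<phi> y"
    and bd: "\<And>y. y \<in> M \<Longrightarrow> (\<phi> y)\<^sup>2 \<le> K * B y y"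
    and x: "x \<in> M" "(\<phi> x)\<^sup>2 = K * B x x" and y: "y \<in> M"
  shows "\<phi> x * \<phi> y = K * B x y"
proof -
  have "\<phi> x * \<phi> y - K * B x y = 0"
  proof (rule linear_coeff_zero)
    fix r
    have "(\<phi> (x + r *\<^sub>R y))\<^sup>2 \<le> K * B (x + r *\<^sub>R y) (x + r *\<^sub>R y)"
      using x y by (intro bd) auto
    then show "2 * r * (\<phi> x * \<phi> y - K * B x y) + r\<^sup>2 * ((\<phi> y)\<^sup>2 - K * B y y) \<le> 0"
      using x(2) B_sym[of y x] by (simp add: lin B_simps algebra_simps power2_eq_square)
  qed
  then show ?thesis by simp
qed

end

section \<open>Extremal frames in Lie 3-algebras\<close>

text \<open>An algebra with k - 3 frozen entries in abstract form. The 4-form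
  \<open>B (t x y z) w\<close> is bounded by l; whether l is attained is left to
  \<open>maximiser\<close>.\<close>

locale lie3_bounded = euclidean_subspace M B
  for M :: "'v::euclidean_space set" and B :: "'v \<Rightarrow> 'v \<Rightarrow> real" +
  fixes t :: "'v \<Rightarrow> 'v \<Rightarrow> 'v \<Rightarrow> 'v" and l :: real
  assumes t_lin3: "t x y (r *\<^sub>R z + w) = r *\<^sub>R t x y z + t x y w"
    and t_swap12: "t y x z = - t x y z"
    and t_swap23: "t x z y = - t x y z"
    and t_M: "x \<in> M \<Longrightarrow> y \<in> M \<Longrightarrow> z \<in> M \<Longrightarrow> t x y z \<in> M"
    and t_FI: "\<lbrakk>x \<in> M; y \<in> M; a \<in> M; b \<in> M; c \<in> M\<rbrakk> \<Longrightarrow>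
      t x y (t a b c) = t (t x y a) b c + t a (t x y b) c + t a b (t x y c)"
    and t_skew: "\<lbrakk>x \<in> M; y \<in> M; z \<in> M; w \<in> M\<rbrakk> \<Longrightarrow> B (t x y z) w = - B (t x y w) z"
    and l_pos: "0 < l"
    and t_bound: "\<lbrakk>x \<in> M; y \<in> M; z \<in> M; w \<in> M\<rbrakk> \<Longrightarrow>
      (B (t x y z) w)\<^sup>2 \<le> l\<^sup>2 * B x x * B y y * B z z * B w w"
begin

lemma t_alt [simp]: "t x x z = 0" "t x z z = 0" "t x z x = 0"
proof -
  show 1: "t x x z = 0" for x z
    using t_swap12[of x x z] by (rule eq_uminus_self)
  show "t x z z = 0" for x z
    using t_swap23[of x z z] by (rule eq_uminus_self)
  show "t x z x = 0" for x z using t_swap23[of x z x] 1[of x z] by simp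
qed

lemma t_rot: "t x y z = t y z x"
  using t_swap12[of x y z] t_swap23[of y x z] by simp

lemma t_add3: "t x y (z + w) = t x y z + t x y w" using t_lin3[of x y 1 z w] by simp
lemma t_zero3: "t x y 0 = 0" using t_add3[of x y 0 0] by simp
lemma t_scale3: "t x y (r *\<^sub>R z) = r *\<^sub>R t x y z" using t_lin3[of x y r z 0] t_zero3 by simp
lemma t_add1: "t (z + w) x y = t z x y + t w x y"
  by (simp only: t_rot[of _ x y] t_add3)
lemma t_add2: "t x (z + w) y = t x z y + t x w y"
  by (simp only: t_rot[of x _ y] t_add1)
lemma t_scale1: "t (r *\<^sub>R z) x y = r *\<^sub>R t z x y"
  by (simp only: t_rot[of _ x y] t_scale3)
lemma t_scale2: "t x (r *\<^sub>R z) y = r *\<^sub>R t x z y"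
  by (simp only: t_rot[of x _ y] t_scale1)
lemma t_zero: "t 0 x y = 0" "t x 0 y = 0"
  using t_scale1[of 0 0 x y] t_scale2[of x 0 0 y] by simp_all
lemma t_minus: "t (- z) x y = - t z x y" "t x (- z) y = - t x z y" "t x y (- z) = - t x y z"
  using t_scale1[of "-1"] t_scale2[of _ "-1"] t_scale3[of _ _ "-1"] by auto
lemma t_diff: "t (z - w) x y = t z x y - t w x y" "t x (z - w) y = t x z y - t x w y" "t x y (z - w) = t x y z - t x y w"
  using t_add1[of z "-w"] t_add2[of _ z "-w"] t_add3[of _ _ z "-w"] by (auto simp: t_minus)

lemmas t_simps = t_add1 t_add2 t_add3 t_scale1 t_scale2 t_scale3 t_zero t_zero3 t_minus t_diff

text \<open>Unit vectors at which the bound l is attained; their orthogonality is a consequence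
  (\<open>maximiser_orthogonal\<close>).\<close>

definition maximiser :: "'v \<Rightarrow> 'v \<Rightarrow> 'v \<Rightarrow> 'v \<Rightarrow> bool" where
  "maximiser p h e f \<longleftrightarrow> p \<in> M \<and> h \<in> M \<and> e \<in> M \<and> f \<in> M \<and>
     B p p = 1 \<and> B h h = 1 \<and> B e e = 1 \<and> B f f = 1 \<and> B (t p h e) f = l"

text \<open>Even permutations leave the alternating 4-form unchanged. Iterating these two lets one
  computation for the pair (p, h) cover all six pairs up to sign.\<close>

lemma maximiser_rot: 
  assumes "maximiser p h e f" shows "maximiser p e f h" and "maximiser e f p h"
proof -
  have M: "p \<in> M" "h \<in> M" "e \<in> M" "f \<in> M" using assms by (auto simp: maximiser_def)
  have 1: "B (t p e f) h = B (t p h e) f"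
    using M t_skew[of p e f h] t_swap23[of p e h] by (simp add: B_simps)
  have 2: "B (t e f p) h = B (t p h e) f"
    using 1 t_rot[of p e f] by simp
  show "maximiser p e f h" "maximiser e f p h" using assms 1 2 by (auto simp: maximiser_def)
qed

text \<open>With three vectors fixed, the form is a linear functional that attains its bound l at
  the fourth, hence is l times the product with that vector (\<open>extremal_functional\<close>).
  Permuting gives the other brackets.\<close>

lemma maximiser_first_order:
  assumes "maximiser p h e f" 
  shows "t p h e = l *\<^sub>R f" "t p h f = - l *\<^sub>R e" "t p e f = l *\<^sub>R h" "t h e f = - l *\<^sub>R p"
    "y \<in> M \<Longrightarrow> B (t p y e) f = l * B h y"
proof -
  have main: "t p h e = l *\<^sub>R f" if mx: "maximiser p h e f" for p h e f
  proof (rule eq_by_B)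
    have M: "p \<in> M" "h \<in> M" "e \<in> M" "f \<in> M" using mx by (auto simp: maximiser_def)
    show "t p h e \<in> M" "l *\<^sub>R f \<in> M" using M by (auto intro: t_M)
    fix z assume z: "z \<in> M"
    have "B (t p h e) f * B (t p h e) z = l\<^sup>2 * B f z"
      by (rule extremal_functional)
         (use z mx t_bound[of p h e] in \<open>auto simp: B_simps maximiser_def\<close>)
    then show "B (t p h e) z = B (l *\<^sub>R f) z"
      using mx l_pos by (simp add: maximiser_def B_simps power2_eq_square)
  qed
  have M: "p \<in> M" "h \<in> M" "e \<in> M" "f \<in> M" using assms by (auto simp: maximiser_def)
  note r = maximiser_rot[OF assms]
  show 1: "t p h e = l *\<^sub>R f" using main[OF assms] .
  show 2: "t p e f = l *\<^sub>R h" using main[OF r(1)] .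
  have "t p f h = l *\<^sub>R e" using main[OF maximiser_rot(1)[OF r(1)]] .
  then show "t p h f = - l *\<^sub>R e" using t_swap23[of p h f] by simp
  have "t e f h = - l *\<^sub>R p" 
    using main[OF maximiser_rot(1)[OF maximiser_rot(1)[OF r(2)]]] t_swap23[of e f h] by simp
  then show "t h e f = - l *\<^sub>R p" using t_rot[of h e f] by simp
  show "B (t p y e) f = l * B h y" if "y \<in> M"
  proof -
    have "B (t p y e) f = B (t p e f) y"
      using M that t_skew[of p e f y] t_swap23[of p e y] by (simp add: B_simps)
    then show ?thesis using 2 by (simp add: B_simps)
  qed
qed

text \<open>By skew-symmetry a bracket is orthogonal to its own entries, and each bracket of three
  of these vectors is a nonzero multiple of the fourth.\<close>

lemma maximiser_orthogonal:
  assumes "maximiser p h e f"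
  shows "B p h = 0" "B p e = 0" "B p f = 0" "B h e = 0" "B h f = 0" "B e f = 0"
proof -
  note fo = maximiser_first_order[OF assms]
  have M: "p \<in> M" "h \<in> M" "e \<in> M" "f \<in> M" using assms by (auto simp: maximiser_def)
  have key: "B (t x y z) x = 0 \<and> B (t x y z) y = 0 \<and> B (t x y z) z = 0" if "x \<in> M" "y \<in> M" "z \<in> M" for x y z
    using that t_skew[of x y z x] t_skew[of x y z y] t_skew[of x y z z] by (auto simp: B_simps)
  show "B p h = 0" "B p e = 0" "B p f = 0" "B h e = 0" "B h f = 0" "B e f = 0"
    using key[of p h e] key[of p e f] key[of h e f] fo M l_pos B_sym
    by (auto simp: B_simps)
qed

definition perp :: "'v \<Rightarrow> 'v \<Rightarrow> 'v \<Rightarrow> 'v \<Rightarrow> 'v set" where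
  "perp p h e f = {w \<in> M. B p w = 0 \<and> B h w = 0 \<and> B e w = 0 \<and> B f w = 0}"

lemma subspace_perp: "subspace (perp p h e f)"
  by (auto simp: perp_def subspace_def B_simps)

text \<open>The operator \<open>t p h\<close> is skew and maps the span of the four vectors to
  itself, so it preserves the orthogonal complement.\<close>

lemma perp_closed:
  assumes mx: "maximiser p h e f" and w: "w \<in> perp p h e f"
  shows "t p h w \<in> perp p h e f" "t p e w \<in> perp p h e f" "t p f w \<in> perp p h e f" "t h e w \<in> perp p h e f"
    "t h f w \<in> perp p h e f" "t e f w \<in> perp p h e f"
proof -
  have main: "t p h w \<in> perp p h e f" if mx: "maximiser p h e f" and w: "w \<in> perp p h e f" for p h e f
  proof -
    note fo = maximiser_first_order[OF mx]
    have M: "p \<in> M" "h \<in> M" "e \<in> M" "f \<in> M" "w \<in> M" using mx w by (auto simp: maximiser_def perp_def)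
    have "B z (t p h w) = - B (t p h z) w" if "z \<in> M" for z
      using t_skew[of p h w z] M that B_sym by metis
    then show ?thesis using fo M w by (auto simp: perp_def t_M B_simps)
  qed
  note r = maximiser_rot[OF mx]
  note rr = maximiser_rot[OF r(1)]
  note rrr = maximiser_rot[OF rr(1)]
  show "t p h w \<in> perp p h e f" using main[OF mx w] .
  show "t p e w \<in> perp p h e f" using main[OF r(1)] w by (auto simp: perp_def)
  show "t p f w \<in> perp p h e f" using main[OF rr(1)] w by (auto simp: perp_def)
  show "t e f w \<in> perp p h e f" using main[OF r(2)] w by (auto simp: perp_def)
  have "t f h w \<in> perp p h e f" using main[OF rr(2)] w by (auto simp: perp_def)
  then show "t h f w \<in> perp p h e f" 
    using subspace_neg[OF subspace_perp, of "t f h w" p h e f] t_swap12[of f h w] by simp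
  show "t h e w \<in> perp p h e f" using main[OF rrr(2)] w by (auto simp: perp_def)
qed

lemma rotation_bound: 
  assumes "p \<in> M" "h \<in> M" "B p p = 1" "B h h = 1" "x \<in> M"
  shows "B (t p h x) (t p h x) \<le> l\<^sup>2 * B x x"
proof (cases "t p h x = 0")
  case True
  then show ?thesis using B_nonneg[OF assms(5)] by (simp add: B_zero)
next
  case False
  have M: "t p h x \<in> M" using assms by (auto intro: t_M)
  then have "B (t p h x) (t p h x) > 0" using False B_pos by auto
  moreover have "(B (t p h x) (t p h x))\<^sup>2 \<le> l\<^sup>2 * B x x * B (t p h x) (t p h x)"
    using t_bound[of p h x "t p h x"] assms M by auto
  ultimately show ?thesis by (simp add: power2_eq_square)
qed

text \<open>If equality held, \<open>(p, h, e + g, f + g')\<close> would be a rescaled maximiser for \<open>g' = [p, h, g] / l\<close>, and its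
  first-order condition contradicts \<open>[ad (p, e), ad (p, f)] = l ad (p, h)\<close>.\<close>

lemma rotation_strict:
  assumes mx: "maximiser p h e f" and g: "g \<in> perp p h e f"
    and eq: "B (t p h g) (t p h g) = l\<^sup>2 * B g g"
  shows "g = 0"
proof (rule ccontr)
  assume "g \<noteq> 0"
  have swap: "t p e g2 = t p f g" if g: "g \<in> perp p h e f" and g2: "g2 \<in> perp p h e f"
    and n: "B g g = 1" "B g2 g2 = 1" and ag: "t p h g = l *\<^sub>R g2" for g g2
  proof (rule eq_by_B)
    note fo = maximiser_first_order[OF mx]
    have M: "p \<in> M" "h \<in> M" "e \<in> M" "f \<in> M" "g \<in> M" "g2 \<in> M"
      using mx g g2 by (auto simp: maximiser_def perp_def)
    show "t p e g2 \<in> M" "t p f g \<in> M" using M by (auto intro: t_M)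
    fix z assume z: "z \<in> M"
    have mx2: "maximiser p h g g2" using mx M n ag by (auto simp: maximiser_def B_simps)
    have o: "B e g = 0" "B f g2 = 0" "B g2 f = 0" "B g e = 0" using g g2 B_sym by (auto simp: perp_def)
    \<comment> \<open>By orthogonality e + g and f + g2 have square norm 2, and the form takes the
      value \<open>2 * l\<close> on them; the factor restores unit vectors.\<close>
    define x where "x = (1 / sqrt 2) *\<^sub>R (e + g)"
    define y where "y = (1 / sqrt 2) *\<^sub>R (f + g2)"
    have "maximiser p h x y"
      using mx M n ag o fo(1) by (auto simp: maximiser_def x_def y_def B_simps t_simps)
    from maximiser_first_order(5)[OF this z] have "B (t p z x) y = l * B h z" .
    then have "B (t p z (e + g)) (f + g2) = 2 * l * B h z"
      by (simp add: x_def y_def t_simps B_simps field_simps)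
    \<comment> \<open>The diagonal terms already contribute \<open>2 * l * B h z\<close>, half from
      each of the maximisers (e, f) and (g, g2), so the mixed terms cancel.\<close>
    then have "B (t p z e) g2 + B (t p z g) f = 0"
      using maximiser_first_order(5)[OF mx z] maximiser_first_order(5)[OF mx2 z]
      by (simp add: B_simps t_simps)
    moreover have "B (t p z e) g2 = B (t p e g2) z"
      using M z t_skew[of p e z g2] t_swap23[of p e z] by (simp add: B_simps)
    moreover have "B (t p z g) f = - B (t p f g) z"
      using M z t_skew[of p g z f] t_swap23[of p g z] t_swap23[of p f g] by (simp add: B_simps)
    ultimately show "B (t p e g2) z = B (t p f g) z" by simp
  qed
  have M: "p \<in> M" "h \<in> M" "e \<in> M" "f \<in> M" "g \<in> M"
    using mx g by (auto simp: maximiser_def perp_def)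
  obtain s where s: "s > 0" "s * s * B g g = 1"
    using normalise[OF g \<open>g \<noteq> 0\<close> subspace_perp] by (auto simp: perp_def)
  define g1 where "g1 = s *\<^sub>R g"
  define g2 where "g2 = (1 / l) *\<^sub>R t p h g1"
  have g1: "g1 \<in> perp p h e f" using g subspace_perp by (auto simp: g1_def intro: subspace_scale)
  have g2: "g2 \<in> perp p h e f" unfolding g2_def
    using perp_closed(1)[OF mx g1] subspace_perp by (auto intro: subspace_scale)
  have n1: "B g1 g1 = 1" using s by (simp add: g1_def B_simps)
  have n2: "B g2 g2 = 1" using s eq l_pos by (simp add: g2_def g1_def B_simps t_simps power2_eq_square field_simps)
  have ag1: "t p h g1 = l *\<^sub>R g2" using l_pos by (simp add: g2_def)
  have "maximiser p h g1 g2" using mx M n1 n2 ag1 g1 g2 by (auto simp: maximiser_def B_simps perp_def)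
  then have ag2: "t p h g2 = l *\<^sub>R (- g1)" using maximiser_first_order(2) by simp
  have b2: "t p e g2 = t p f g1" using swap[OF g1 g2 n1 n2 ag1] .
  \<comment> \<open>The pair (g2, -g1) is again turned by \<open>t p h\<close> at speed l, so
    \<open>swap\<close> applies a second time.\<close>
  have "t p e (- g1) = t p f g2"
    by (rule swap[OF g2 _ n2 _ ag2]) (use g1 n1 subspace_neg[OF subspace_perp] in \<open>auto simp: B_simps\<close>)
  then have b1: "t p e g1 = - t p f g2" by (metis t_minus(3) minus_minus)
  have Mg: "g1 \<in> M" "g2 \<in> M" using g1 g2 by (auto simp: perp_def)
  \<comment> \<open>Pairing this commutator with g2 gives \<open>l\<^sup>2\<close>, while
    \<open>b1\<close> and \<open>b2\<close> turn it into minus a sum of two squares.\<close>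
  have "t p e (t p f g1) - t p f (t p e g1) = l *\<^sub>R t p h g1"
    using t_FI[of p e p f g1] M Mg maximiser_first_order(3)[OF mx] by (simp add: t_simps)
  then have "B (t p e (t p f g1) - t p f (t p e g1)) g2 = l\<^sup>2"
    using ag1 n2 by (simp add: B_simps power2_eq_square)
  moreover have "B (t p e (t p f g1)) g2 = - B (t p f g1) (t p f g1)"
    using t_skew[of p e "t p f g1" g2] M Mg b2 t_M by (simp add: B_simps)
  moreover have "B (t p f (t p e g1)) g2 = B (t p e g1) (t p e g1)"
    using t_skew[of p f "t p e g1" g2] M Mg b1 t_M by (simp add: B_simps)
  moreover have "B (t p f g1) (t p f g1) \<ge> 0" "B (t p e g1) (t p e g1) \<ge> 0"
    using M Mg t_M by (auto intro: B_nonneg)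
  ultimately have "l\<^sup>2 \<le> 0" unfolding B_diff by linarith
  then show False using l_pos by simp
qed

text \<open>Here b and c raise the weight of \<open>ad (p, h)\<close> from \<open>\<nu>\<close> to \<open>\<nu> + l\<close>, which exceeds the maximum l.\<close>

lemma raising_vanishes:
  assumes mx: "maximiser p h e f"
    and bc: "\<And>x. x \<in> M \<Longrightarrow> t p h (b x) = l *\<^sub>R c x + b (t p h x)"
      "\<And>x. x \<in> M \<Longrightarrow> t p h (c x) = - l *\<^sub>R b x + c (t p h x)"
    and cl: "\<And>x. x \<in> M \<Longrightarrow> b x \<in> M" "\<And>x. x \<in> M \<Longrightarrow> c x \<in> M"
    and lin: "linear b" "linear c"
    and g: "g \<in> M" "g2 \<in> M" "t p h g = \<nu> *\<^sub>R g2" "t p h g2 = - \<nu> *\<^sub>R g" "\<nu> > 0"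
  shows "b g = c g2" "c g = - b g2"
proof -
  have M: "p \<in> M" "h \<in> M" "B p p = 1" "B h h = 1" using mx by (auto simp: maximiser_def)
  \<comment> \<open>Real and imaginary parts: y - i z = (b - i c)(g - i g2), where b - i c has
    weight l and g - i g2 has weight \<nu> under \<open>t p h\<close>.\<close>
  define y where "y = b g - c g2"
  define z where "z = c g + b g2"
  have y: "y \<in> M" and z: "z \<in> M" using cl g by (auto simp: y_def z_def)
  have 1: "t p h y = (l + \<nu>) *\<^sub>R z"
    using bc g by (simp add: y_def z_def t_simps linear_scale[OF lin(1)] linear_scale[OF lin(2)] linear_neg[OF lin(1)] linear_neg[OF lin(2)] algebra_simps)
  have 2: "t p h z = - (l + \<nu>) *\<^sub>R y"
    using bc g by (simp add: y_def z_def t_simps linear_scale[OF lin(1)] linear_scale[OF lin(2)] linear_neg[OF lin(1)] linear_neg[OF lin(2)] algebra_simps)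
  have 3: "(l + \<nu>)\<^sup>2 * B z z \<le> l\<^sup>2 * B y y" "(l + \<nu>)\<^sup>2 * B y y \<le> l\<^sup>2 * B z z"
    using rotation_bound[OF M(1,2,3,4) y] rotation_bound[OF M(1,2,3,4) z]
    by (simp_all add: 1 2 B_simps power2_eq_square algebra_simps)
  have lt: "l\<^sup>2 < (l + \<nu>)\<^sup>2" using l_pos g(5) by (intro power_strict_mono) auto
  have nn: "B y y \<ge> 0" "B z z \<ge> 0" using y z B_nonneg by auto
  have "((l + \<nu>)\<^sup>2 - l\<^sup>2) * (B y y + B z z) \<le> 0" using 3 by (simp add: algebra_simps)
  then have "B y y + B z z \<le> 0" using lt by (simp add: mult_le_0_iff)
  then have "y = 0" "z = 0" using nn y z B_eq_0_iff[of y] B_eq_0_iff[of z] by linarith+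
  then show "b g = c g2" "c g = - b g2" by (auto simp: y_def z_def eq_neg_iff_add_eq_0)
qed

lemma linear_t: "linear (t x y)"
  by (auto intro!: linearI simp: t_simps)

text \<open>Let \<nu> be the largest rotation speed of \<open>t p h\<close> on the complement and
  (g, g2) a plane realising it. Since this weight cannot be raised, the fundamental identity forces
  \<open>t e f g2 = 0\<close>. Then \<open>t p e g2\<close> and \<open>t p f g2\<close> would have
  the forbidden weight l under \<open>t e f\<close>, so they vanish, and the commutator of
  \<open>t p e\<close> and \<open>t p f\<close> gives \<open>t p h g2 = 0\<close>.\<close>

theorem maximiser_rotation_vanishes:
  assumes mx: "maximiser p h e f" and w: "w \<in> perp p h e f"
  shows "t p h w = 0"
proof (rule ccontr)
  assume nz: "t p h w \<noteq> 0"
  then have "w \<noteq> 0" by (auto simp: t_simps)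
  let ?P = "perp p h e f"
  have PM: "?P \<subseteq> M" by (auto simp: perp_def)
  obtain g where g: "g \<in> ?P" "B g g = 1"
    "\<And>x. x \<in> ?P \<Longrightarrow> B (t p h x) (t p h x) \<le> B (t p h g) (t p h g) * B x x"
    using top_vector[OF subspace_perp PM w \<open>w \<noteq> 0\<close> linear_t] by metis
  define n where "n = B (t p h g) (t p h g)"
  note P = perp_closed[OF mx]
  have M: "p \<in> M" "h \<in> M" "e \<in> M" "f \<in> M" using mx by (auto simp: maximiser_def)
  have npos: "n > 0"
  proof -
    have "B (t p h w) (t p h w) > 0" using nz P(1)[OF w] PM B_pos by auto
    then have "n * B w w > 0" using g(3)[OF w] by (simp add: n_def)
    moreover have "B w w \<ge> 0" using w PM B_nonneg by auto
    ultimately show ?thesis by (simp add: zero_less_mult_iff)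
  qed
  define \<nu> where "\<nu> = sqrt n"
  have \<nu>: "\<nu> > 0" "\<nu> * \<nu> = n" using npos by (auto simp: \<nu>_def)
  \<comment> \<open>Euler-Lagrange equation: the maximum g of the quadratic form is an eigenvector
    of the symmetric operator \<open>t p h\<close> squared.\<close>
  have sq: "t p h (t p h g) = - n *\<^sub>R g"
  proof -
    have "B (t p h (t p h g) + n *\<^sub>R g) y = 0" if y: "y \<in> ?P" for y
    proof -
      have "B (t p h g) (t p h y) - n * B g y = 0"
      proof (rule linear_coeff_zero)
        fix r
        have "B (t p h (g + r *\<^sub>R y)) (t p h (g + r *\<^sub>R y)) \<le> n * B (g + r *\<^sub>R y) (g + r *\<^sub>R y)"
          unfolding n_def using g(1) y
          by (intro g(3) subspace_add[OF subspace_perp] subspace_scale[OF subspace_perp])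
        then show "2 * r * (B (t p h g) (t p h y) - n * B g y) + r\<^sup>2 * (B (t p h y) (t p h y) - n * B y y) \<le> 0"
          using g(2) B_sym[of y g] B_sym[of "t p h y" "t p h g"]
          by (simp add: t_simps B_simps n_def algebra_simps power2_eq_square)
      qed
      moreover have "B (t p h (t p h g)) y = - B (t p h g) (t p h y)"
        using t_skew[of p h "t p h g" y] M P(1)[OF g(1)] y PM B_sym[of "t p h y"] by auto
      ultimately show ?thesis by (simp add: B_simps)
    qed
    moreover have "t p h (t p h g) + n *\<^sub>R g \<in> ?P"
      using P(1) g(1) subspace_perp by (intro subspace_add subspace_scale) auto
    ultimately have "t p h (t p h g) + n *\<^sub>R g = 0"
      using PM B_eq_0_iff by blast
    then show ?thesis by (simp add: eq_neg_iff_add_eq_0)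
  qed
  define g2 where "g2 = (1 / \<nu>) *\<^sub>R t p h g"
  have ag: "t p h g = \<nu> *\<^sub>R g2" using \<nu> by (simp add: g2_def)
  have ag2: "t p h g2 = - \<nu> *\<^sub>R g"
    using \<nu> sq by (simp add: g2_def t_simps flip: \<nu>(2))
  have g2: "g2 \<in> ?P" unfolding g2_def using P(1)[OF g(1)] subspace_perp by (auto intro: subspace_scale)
  have gM: "g \<in> M" "g2 \<in> M" using g g2 PM by auto
  note fo = maximiser_first_order[OF mx]
  have rots: "t e f p = l *\<^sub>R h" "t e f h = - l *\<^sub>R p" "t h e p = l *\<^sub>R f" "t p e h = - l *\<^sub>R f" "t f e x = - t e f x" for x
    using fo t_rot[of p e f] t_rot[of h e f] t_rot[of p h e] t_swap23[of p e h] t_swap12[of e f x] by simp_all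
  \<comment> \<open>Commutation relations of so(4), from the fundamental identity and the brackets
    among p, h, e, f.\<close>
  have com1: "t p h (t p e x) = l *\<^sub>R t p f x + t p e (t p h x)"
    "t p h (t p f x) = - l *\<^sub>R t p e x + t p f (t p h x)"
    "t p h (t h e x) = l *\<^sub>R t h f x + t h e (t p h x)"
    "t p h (t h f x) = - l *\<^sub>R t h e x + t h f (t p h x)"
    "t h e (t p e x) = - l *\<^sub>R t e f x + t p e (t h e x)"
    "t p e (t h f x) = t h f (t p e x)"
    "t p e (t p f x) = l *\<^sub>R t p h x + t p f (t p e x)"
    "t e f (t p e x) = l *\<^sub>R t h e x + t p e (t e f x)"
    "t e f (t h e x) = - l *\<^sub>R t p e x + t h e (t e f x)"
    "t e f (t p f x) = l *\<^sub>R t h f x + t p f (t e f x)"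
    "t e f (t h f x) = - l *\<^sub>R t p f x + t h f (t e f x)"
    if x: "x \<in> M" for x
    using t_FI[of p h p e x] t_FI[of p h p f x] t_FI[of p h h e x] t_FI[of p h h f x] t_FI[of h e p e x]
      t_FI[of p e h f x] t_FI[of p e p f x] t_FI[of e f p e x] t_FI[of e f h e x] t_FI[of e f p f x] t_FI[of e f h f x] M x
    by (simp_all add: fo rots t_simps)
  \<comment> \<open>Each of the pairs \<open>t p e\<close>, \<open>t p f\<close> and
    \<open>t h e\<close>, \<open>t h f\<close> contains a raising operator, which must kill the top
    plane.\<close>
  have bc: "t p e g = t p f g2" "t p f g = - t p e g2"
    using raising_vanishes[OF mx com1(1,2) _ _ linear_t linear_t gM ag ag2 \<nu>(1)] M t_M by auto
  have bc': "t h e g = t h f g2" "t h f g = - t h e g2"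
    using raising_vanishes[OF mx com1(3,4) _ _ linear_t linear_t gM ag ag2 \<nu>(1)] M t_M by auto
  \<comment> \<open>Here x is one of the acting entries: [p, x, [h, e, f]] is a multiple of
    [p, x, p] = 0. This is not a commutator relation; it couples the two commuting su(2) factors of
    so(4).\<close>
  have rel: "t e f (t p h x) = t h f (t p e x) - t h e (t p f x)" if x: "x \<in> M" for x
  proof -
    have "0 = t (t p x h) e f + t h (t p x e) f + t h e (t p x f)"
      using t_FI[of p x h e f] M x by (simp add: fo t_simps)
    moreover have "t p x h = - t p h x" "t p x e = - t p e x" "t p x f = - t p f x"
      using t_swap23[of p _ x] by auto
    moreover have "t (t p h x) e f = t e f (t p h x)" 
      by (rule t_rot)
    moreover have "t h (t p e x) f = - t h f (t p e x)" 
      by (rule t_swap23)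
    ultimately show ?thesis by (simp add: t_simps algebra_simps)
  qed
  \<comment> \<open>With the raising parts removed, the right side becomes a commutator, so
    \<open>t e f g2\<close> is multiplied by \<nu> on one side and by -l on the other.\<close>
  have "\<nu> *\<^sub>R t e f g2 = t h f (t p e g) - t h e (t p f g)"
    using rel[OF gM(1)] by (simp add: ag t_simps)
  also have "\<dots> = t p e (t h f g) + t h e (t p e g2)"
    using com1(6)[OF gM(1)] by (simp add: bc(2) t_simps)
  also have "\<dots> = - l *\<^sub>R t e f g2"
    using com1(5)[OF gM(2)] by (simp add: bc'(2) t_simps)
  finally have "(\<nu> + l) *\<^sub>R t e f g2 = 0" by (simp add: algebra_simps)
  then have z: "t e f g2 = 0" using \<nu> l_pos by simp
  note mx' = maximiser_rot(2)[OF mx]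
  \<comment> \<open>Weight l under \<open>t e f\<close> is excluded by
    \<open>rotation_strict\<close> for the maximiser (e, f, p, h).\<close>
  have vanish: "x = 0" if "x \<in> ?P" "t e f (t e f x) = - (l * l) *\<^sub>R x" for x
  proof (rule rotation_strict[OF mx'])
    show "x \<in> perp e f p h" using that(1) by (simp add: perp_def)
    have "x \<in> M" "t e f x \<in> M" using that(1) P(6)[OF that(1)] PM by auto
    then have "B (t e f x) (t e f x) = - B (t e f (t e f x)) x"
      using t_skew[of e f "t e f x" x] M by simp
    then show "B (t e f x) (t e f x) = l\<^sup>2 * B x x"
      using that by (simp add: B_simps power2_eq_square)
  qed
  \<comment> \<open>As \<open>t e f g2 = 0\<close>, the commutators show that \<open>t e f\<close>
    maps \<open>t p e g2\<close> to \<open>l *\<^sub>R t h e g2\<close>, and the latter to minus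
    \<open>l\<^sup>2\<close> times \<open>t p e g2\<close>.\<close>
  have "t p e g2 = 0"
    by (rule vanish) (use P(2)[OF g2] com1(8,9)[OF gM(2)] z in \<open>simp_all add: t_simps\<close>)
  moreover have "t p f g2 = 0"
    by (rule vanish) (use P(3)[OF g2] com1(10,11)[OF gM(2)] z in \<open>simp_all add: t_simps\<close>)
  ultimately have "t p h g2 = 0"
    using com1(7)[OF gM(2)] l_pos by (simp add: t_simps)
  then have "g = 0" using ag2 \<nu> by simp
  then show False using g(2) by (simp add: B_zero)
qed

end

section \<open>Alternating maps on lists\<close>

locale alternating_map =
  fixes m :: nat and f :: "'v::euclidean_space list \<Rightarrow> 'w::real_normed_vector"
  assumes multilin: "multilinear_on UNIV m f" and alternating: "alternating_on UNIV m f"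
begin

lemma vanish: "length xs = m \<Longrightarrow> \<not> distinct xs \<Longrightarrow> f xs = 0"
  using alternating by (auto simp: alternating_on_def)

lemma linear_slot:
  assumes "length xs + length zs + 1 = m"
  shows "linear (\<lambda>x. f (xs @ x # zs))"
proof (rule linearI)
  have eq: "f (xs @ (a *\<^sub>R x + b *\<^sub>R y) # zs) = a *\<^sub>R f (xs @ x # zs) + b *\<^sub>R f (xs @ y # zs)" for a b x y
    using multilin[unfolded multilinear_on_def, rule_format, of "xs @ 0 # zs" "length xs" x y a b] assms
    by simp
  show "f (xs @ (x + y) # zs) = f (xs @ x # zs) + f (xs @ y # zs)" for x y using eq[of 1 x 1 y] by simp
  show "f (xs @ (r *\<^sub>R x) # zs) = r *\<^sub>R f (xs @ x # zs)" for r x using eq[of r x 0 0] by simp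
qed

lemmas slot_add = linear_add[OF linear_slot]
  and slot_diff = linear_diff[OF linear_slot]
  and slot_scale = linear_scale[OF linear_slot]
  and slot_neg = linear_neg[OF linear_slot]
  and slot_0 = linear_0[OF linear_slot]
  and slot_sum = linear_sum[OF linear_slot]

lemma swap:
  assumes "length xs + length zs + 2 = m"
  shows "f (xs @ x # y # zs) = - f (xs @ y # x # zs)"
proof -
  have l: "length xs + length (c # zs) + 1 = m" "length (xs @ [c]) + length zs + 1 = m" for c
    using assms by auto
  have add2: "f (xs @ c # (a + b) # zs) = f (xs @ c # a # zs) + f (xs @ c # b # zs)" for a b c
    using slot_add[OF l(2), of c a b] by simp
  have "0 = f (xs @ (x + y) # (x + y) # zs)" using assms by (intro vanish[symmetric]) auto
  also have "\<dots> = f (xs @ x # x # zs) + f (xs @ x # y # zs) + (f (xs @ y # x # zs) + f (xs @ y # y # zs))"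
    by (simp add: slot_add[OF l(1)] add2)
  also have "f (xs @ x # x # zs) = 0" using assms by (intro vanish) auto
  also have "f (xs @ y # y # zs) = 0" using assms by (intro vanish) auto
  finally show ?thesis by (simp add: eq_neg_iff_add_eq_0)
qed

lemma move:
  assumes "length ps + length us + length vs + 1 = m"
  shows "f (ps @ us @ x # vs) = (-1) ^ length us *\<^sub>R f (ps @ x # us @ vs)"
  using assms
proof (induction us arbitrary: ps)
  case (Cons u us)
  have "f (ps @ (u # us) @ x # vs) = (-1) ^ length us *\<^sub>R f (ps @ u # x # us @ vs)"
    using Cons.IH[of "ps @ [u]"] Cons.prems by simp
  also have "f (ps @ u # x # us @ vs) = - f (ps @ x # u # us @ vs)"
    using Cons.prems by (intro swap) auto
  finally show ?case by simp
qed auto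

text \<open>The sign is left open: the uses below only concern vanishing, absolute values or
  membership in a subspace. Where it matters, \<open>move\<close> tracks it.\<close>

lemma permute:
  assumes "mset xs = mset ys" "length xs = m"
  shows "f xs = f ys \<or> f xs = - f ys"
proof -
  have "f (ps @ xs) = f (ps @ ys) \<or> f (ps @ xs) = - f (ps @ ys)"
    if "mset xs = mset ys" "length ps + length xs = m" for ps xs ys
    using that
  proof (induction xs arbitrary: ps ys)
    case (Cons x xs)
    have "x \<in> set ys" using Cons.prems by (metis list.set_intros(1) mset_eq_setD)
    then obtain us vs where ys: "ys = us @ x # vs" by (meson split_list)
    have len: "length ys = length (x # xs)" using Cons.prems mset_eq_length by metis
    have mv: "f (ps @ ys) = (-1) ^ length us *\<^sub>R f (ps @ x # us @ vs)"
      using move[of ps us vs x] Cons.prems len by (simp add: ys)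
    have "f ((ps @ [x]) @ xs) = f ((ps @ [x]) @ (us @ vs)) \<or> f ((ps @ [x]) @ xs) = - f ((ps @ [x]) @ (us @ vs))"
      using Cons.prems by (intro Cons.IH) (auto simp: ys)
    moreover have "(-1::real) ^ length us = 1 \<or> (-1::real) ^ length us = -1"
      by (cases "even (length us)") auto
    ultimately show ?case using mv by auto
  qed auto
  from this[of xs ys "[]"] show ?thesis using assms by simp
qed

lemma scale_all:
  assumes "length ps + length xs = m"
  shows "f (ps @ map (\<lambda>x. c x *\<^sub>R x) xs) = prod_list (map c xs) *\<^sub>R f (ps @ xs)"
  using assms
proof (induction xs arbitrary: ps)
  case (Cons x xs)
  have "f (ps @ map (\<lambda>x. c x *\<^sub>R x) (x # xs)) = c x *\<^sub>R f (ps @ x # map (\<lambda>x. c x *\<^sub>R x) xs)"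
    using Cons.prems by (simp add: slot_scale)
  also have "\<dots> = c x *\<^sub>R prod_list (map c xs) *\<^sub>R f (ps @ x # xs)"
    using Cons.IH[of "ps @ [x]"] Cons.prems by simp
  finally show ?case by simp
qed simp

text \<open>Continuity one slot at a time: the last varying entry is expanded in the standard basis,
  and each basis vector joins the constant tail zs.\<close>

lemma tendsto_slots:
  assumes "j + length zs = m" "\<And>i. i < j \<Longrightarrow> (\<lambda>n. X n i) \<longlonglongrightarrow> L i"
  shows "(\<lambda>n. f (map (X n) [0..<j] @ zs)) \<longlonglongrightarrow> f (map L [0..<j] @ zs)"
  using assms
proof (induction j arbitrary: zs)
  case (Suc j)
  have expand: "f (map Y [0..<Suc j] @ zs) = (\<Sum>b\<in>Basis. (Y j \<bullet> b) *\<^sub>R f (map Y [0..<j] @ b # zs))"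
    for Y :: "nat \<Rightarrow> 'v"
  proof -
    have "f (map Y [0..<Suc j] @ zs) = f (map Y [0..<j] @ (\<Sum>b\<in>Basis. (Y j \<bullet> b) *\<^sub>R b) # zs)"
      by (simp add: euclidean_representation)
    also have "\<dots> = (\<Sum>b\<in>Basis. f (map Y [0..<j] @ ((Y j \<bullet> b) *\<^sub>R b) # zs))"
      using Suc.prems by (intro slot_sum) auto
    also have "\<dots> = (\<Sum>b\<in>Basis. (Y j \<bullet> b) *\<^sub>R f (map Y [0..<j] @ b # zs))"
      using Suc.prems by (intro sum.cong slot_scale) auto
    finally show ?thesis .
  qed
  show ?case unfolding expand
    using Suc.prems by (intro tendsto_sum tendsto_scaleR tendsto_inner tendsto_const Suc.IH) auto
qed simp

end

text \<open>Sequential compactness of a finite power of K, refining the subsequence once for each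
  component.\<close>

lemma componentwise_subsequence:
  fixes X :: "nat \<Rightarrow> nat \<Rightarrow> 'a::metric_space"
  assumes "compact K" "\<And>n i. i < j \<Longrightarrow> X n i \<in> K"
  shows "\<exists>r L. strict_mono r \<and> (\<forall>i<j. L i \<in> K \<and> (\<lambda>n. X (r n) i) \<longlonglongrightarrow> L i)"
  using assms(2)
proof (induction j)
  case 0
  show ?case using strict_mono_id by blast
next
  case (Suc j)
  have "\<And>n i. i < j \<Longrightarrow> X n i \<in> K" using Suc.prems by simp
  from Suc.IH[OF this] obtain r L where
    r: "strict_mono r" "\<And>i. i < j \<Longrightarrow> L i \<in> K \<and> (\<lambda>n. X (r n) i) \<longlonglongrightarrow> L i" by blast
  have "\<forall>n. X (r n) j \<in> K" using Suc.prems by auto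
  then obtain l r' where r': "l \<in> K" "strict_mono r'" "((\<lambda>n. X (r n) j) \<circ> r') \<longlonglongrightarrow> l"
    using assms(1) unfolding compact_eq_seq_compact_metric seq_compact_def by metis
  have "strict_mono (r \<circ> r')" using r r' by (simp add: strict_mono_o)
  moreover have "(L(j := l)) i \<in> K \<and> (\<lambda>n. X ((r \<circ> r') n) i) \<longlonglongrightarrow> (L(j := l)) i" if "i < Suc j" for i
  proof (cases "i = j")
    case True
    then show ?thesis using r' by (simp add: o_def)
  next
    case False
    then have "i < j" using that by simp
    then show ?thesis using LIMSEQ_subseq_LIMSEQ[OF conjunct2[OF r(2)] r'(2)] r(2) False by (simp add: o_def)
  qed
  ultimately show ?case by blast
qed

text \<open>Compactness is shown for the set of values: a sequence of values lifts to lists whose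
  entries converge along a common subsequence, and \<open>tendsto_slots\<close> carries the limit
  over.\<close>

lemma alternating_form_attains_max:
  fixes F :: "'v::euclidean_space list \<Rightarrow> real"
  assumes F: "alternating_map m F" and K: "compact K" "K \<noteq> {}"
  obtains s where "length s = m" "set s \<subseteq> K" "\<And>xs. length xs = m \<Longrightarrow> set xs \<subseteq> K \<Longrightarrow> F xs \<le> F s"
proof -
  interpret alternating_map m F by fact
  let ?L = "{xs. length xs = m \<and> set xs \<subseteq> K}"
  have cpt: "compact (F ` ?L)"
    unfolding compact_eq_seq_compact_metric seq_compact_def
  proof (intro allI impI)
    fix g :: "nat \<Rightarrow> real" assume "\<forall>n. g n \<in> F ` ?L"
    then have "\<forall>n. \<exists>xs. xs \<in> ?L \<and> g n = F xs" by blast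
    then obtain Y where Y: "\<And>n. Y n \<in> ?L" "\<And>n. g n = F (Y n)" by metis
    define X where "X n i = Y n ! i" for n i :: nat
    have "X n i \<in> K" if "i < m" for n i
      using Y(1)[of n] that by (auto simp: X_def)
    then obtain r L where r: "strict_mono r" "\<forall>i<m. L i \<in> K \<and> (\<lambda>n. X (r n) i) \<longlonglongrightarrow> L i"
      using componentwise_subsequence[OF K(1), of m X] by blast
    have "map (X n) [0..<m] = Y n" for n using Y(1)[of n] by (auto simp: X_def intro: nth_equalityI)
    then have "(\<lambda>n. F (Y (r n))) \<longlonglongrightarrow> F (map L [0..<m])"
      using tendsto_slots[of m "[]" "\<lambda>n. X (r n)" L] r(2) by simp
    moreover have "map L [0..<m] \<in> ?L" using r(2) by auto
    moreover have "g \<circ> r = (\<lambda>n. F (Y (r n)))" by (auto simp: Y(2))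
    ultimately show "\<exists>l\<in>F ` ?L. \<exists>r. strict_mono r \<and> (g \<circ> r) \<longlonglongrightarrow> l"
      using r(1) by (intro bexI[of _ "F (map L [0..<m])"] exI[of _ r]) auto
  qed
  have ne: "F ` ?L \<noteq> {}"
  proof -
    obtain x where "x \<in> K" using K(2) by auto
    then have "replicate m x \<in> ?L" by (auto simp: set_replicate_conv_if)
    then show ?thesis by blast
  qed
  obtain s where "s \<in> ?L" "\<forall>z\<in>F ` ?L. z \<le> F s"
    using compact_attains_sup[OF cpt ne] by blast
  then show ?thesis by (intro that[of s]) auto
qed

section \<open>Orthonormal systems in a positive definite subspace\<close>

context euclidean_subspace begin

lemma orthonormal_decomposition:
  assumes A: "finite A" "A \<subseteq> M" "\<And>a b. a \<in> A \<Longrightarrow> b \<in> A \<Longrightarrow> B a b = (if a = b then 1 else 0)"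
  obtains p where "p \<in> span A" "p \<in> M" "\<And>a. a \<in> A \<Longrightarrow> B a (y - p) = 0"
proof
  define p where "p = (\<Sum>a\<in>A. B y a *\<^sub>R a)"
  have lin: "linear (\<lambda>x. B x z)" for z by (auto intro!: linearI simp: B_simps)
  show p: "p \<in> span A" unfolding p_def by (intro span_sum span_scale span_base)
  then show "p \<in> M" using A(2) sub span_minimal by blast
  show "B a (y - p) = 0" if "a \<in> A" for a
  proof -
    have "B p a = (\<Sum>c\<in>A. B (B y c *\<^sub>R c) a)" unfolding p_def by (rule linear_sum[OF lin])
    also have "\<dots> = (\<Sum>c\<in>A. if c = a then B y a else 0)"
      using that by (intro sum.cong) (auto simp: B_simps A(3))
    also have "\<dots> = B y a" using that A(1) by simp
    finally show ?thesis using B_sym[of a] by (simp add: B_simps)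
  qed
qed

lemma span_orthogonal:
  assumes "x \<in> span A" "\<And>a. a \<in> A \<Longrightarrow> B a w = 0" shows "B x w = 0"
proof -
  have "subspace {x. B x w = 0}" by (auto simp: subspace_def B_simps)
  then have "span A \<subseteq> {x. B x w = 0}" using assms(2) by (intro span_minimal) auto
  then show ?thesis using assms(1) by auto
qed

lemma in_span_orthonormal:
  assumes A: "finite A" "A \<subseteq> M" "\<And>a b. a \<in> A \<Longrightarrow> b \<in> A \<Longrightarrow> B a b = (if a = b then 1 else 0)"
    and y: "y \<in> M" "\<And>w. w \<in> M \<Longrightarrow> (\<And>a. a \<in> A \<Longrightarrow> B a w = 0) \<Longrightarrow> B y w = 0"
  shows "y \<in> span A"
proof -
  obtain p where p: "p \<in> span A" "p \<in> M" "\<And>a. a \<in> A \<Longrightarrow> B a (y - p) = 0"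
    using orthonormal_decomposition[OF A] by metis
  have "B y (y - p) = 0" using y(1) p by (intro y(2)) auto
  moreover have "B p (y - p) = 0" using p by (intro span_orthogonal[OF p(1)])
  ultimately have "B (y - p) (y - p) = 0" by (simp add: B_diff(1))
  then have "y = p" using B_eq_0_iff[of "y - p"] y(1) p(2) by auto
  then show ?thesis using p by simp
qed

lemma independent_orthogonal:
  assumes "\<And>a b. a \<in> A \<Longrightarrow> b \<in> A \<Longrightarrow> a \<noteq> b \<Longrightarrow> B a b = 0" "\<And>a. a \<in> A \<Longrightarrow> B a a \<noteq> 0"
  shows "independent A"
  unfolding dependent_def
proof
  assume "\<exists>a\<in>A. a \<in> span (A - {a})"
  then obtain a where a: "a \<in> A" "a \<in> span (A - {a})" by blast
  have "B a a = 0" using a assms(1) by (intro span_orthogonal[OF a(2)]) auto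
  then show False using assms(2) a by auto
qed

end

lemma mset_split_last:
  assumes "x \<in> set s" obtains ys where "mset s = mset (ys @ [x])"
proof -
  obtain us vs where "s = us @ x # vs" using assms by (meson split_list)
  then have "mset s = mset ((us @ vs) @ [x])" by simp
  then show ?thesis by (rule that)
qed

lemma list_split_last3:
  assumes "3 \<le> length xs"
  obtains X a b c where "xs = X @ [a, b, c]"
proof -
  define j where "j = length xs - 3"
  have "length (drop j xs) = 3" using assms by (simp add: j_def)
  then obtain a b c where "drop j xs = [a, b, c]" unfolding numeral_3_eq_3 length_Suc_conv by auto
  then have "xs = take j xs @ [a, b, c]" by (metis append_take_drop_id)
  then show ?thesis using that by blast
qed

section \<open>Euclidean Lie k-algebras\<close>

text \<open>\<open>F\<close> is a parameter of its own, tied to the bracket only on M: a projected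
  bracket such as \<open>brW\<close> shares its form with the unprojected one. That \<open>F\<close>
  alternates encodes the skew-symmetry of all \<open>ad\<close>.\<close>

locale euclidean_lie_k = euclidean_subspace M B + br: alternating_map k br + F: alternating_map "Suc k" F
  for M :: "'v::euclidean_space set" and B k and br :: "'v list \<Rightarrow> 'v" and F :: "'v list \<Rightarrow> real" +
  assumes k3: "3 \<le> k"
    and br_M: "length xs = k \<Longrightarrow> set xs \<subseteq> M \<Longrightarrow> br xs \<in> M"
    and F_eq: "length xs = k \<Longrightarrow> set xs \<subseteq> M \<Longrightarrow> z \<in> M \<Longrightarrow> F (xs @ [z]) = B (br xs) z"
    and br_FI: "\<lbrakk>length xs = k - 1; set xs \<subseteq> M; length ys = k; set ys \<subseteq> M\<rbrakk> \<Longrightarrow>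
      br (xs @ [br ys]) = (\<Sum>i<k. br (ys[i := br (xs @ [ys ! i])]))"
begin

text \<open>The homogeneous bound applies to arbitrary vectors of M, and squaring makes it
  independent of the orientation of s.\<close>

definition maximal_frame :: "'v list \<Rightarrow> bool" where
  "maximal_frame s \<longleftrightarrow> length s = Suc k \<and> set s \<subseteq> M \<and> (\<forall>x\<in>set s. B x x = 1) \<and> F s \<noteq> 0 \<and>
     (\<forall>xs. length xs = Suc k \<and> set xs \<subseteq> M \<longrightarrow> (F xs)\<^sup>2 \<le> (F s)\<^sup>2 * prod_list (map (\<lambda>x. B x x) xs))"

text \<open>The maximum over unit vectors is nonzero because \<open>F\<close> at
  \<open>xs0 @ [br xs0]\<close> is the square norm of a nonzero bracket; rescaling the entries makes
  the bound homogeneous.\<close>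

lemma maximal_frame_exists:
  assumes xs0: "length xs0 = k" "set xs0 \<subseteq> M" "br xs0 \<noteq> 0"
  obtains s where "maximal_frame s"
proof -
  let ?K = "{x \<in> M. B x x = 1}"
  have br0: "br xs0 \<in> M" using xs0 br_M by auto
  have nz: "F (xs0 @ [br xs0]) \<noteq> 0" using F_eq[OF xs0(1,2) br0] B_pos[OF br0] xs0 by simp
  obtain r where "r *\<^sub>R br xs0 \<in> ?K"
    using normalise[OF br0 xs0(3) sub] by auto
  then have "?K \<noteq> {}" by blast
  then obtain s where s: "length s = Suc k" "set s \<subseteq> ?K"
    "\<And>xs. length xs = Suc k \<Longrightarrow> set xs \<subseteq> ?K \<Longrightarrow> F xs \<le> F s"
    using alternating_form_attains_max[OF F.alternating_map_axioms compact_unit_sphere[OF sub]] by blast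
  \<comment> \<open>The unit sphere is symmetric and negating one entry negates \<open>F\<close>, so
    the maximum also bounds absolute values.\<close>
  have abs: "\<bar>F xs\<bar> \<le> F s" if xs: "length xs = Suc k" "set xs \<subseteq> ?K" for xs
  proof -
    obtain y ys where y: "xs = y # ys" using xs by (cases xs) auto
    have "F (- y # ys) = - F xs" using F.slot_neg[of "[]" ys y] xs y by simp
    moreover have "F (- y # ys) \<le> F s" using xs y by (intro s(3)) (auto simp: B_simps)
    ultimately show ?thesis using s(3)[OF xs] by simp
  qed
  have bound: "(F xs)\<^sup>2 \<le> (F s)\<^sup>2 * prod_list (map (\<lambda>x. B x x) xs)"
    if xs: "length xs = Suc k" "set xs \<subseteq> M" for xs
  proof (cases "0 \<in> set xs")
    case True
    then obtain us vs where "xs = us @ 0 # vs" by (meson split_list)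
    then have "F xs = 0" using F.slot_0[of us vs] xs by simp
    moreover have "prod_list (map (\<lambda>x. B x x) xs) = 0" using True by (force simp: prod_list_zero_iff B_zero)
    ultimately show ?thesis by simp
  next
    case False
    define c where "c x = 1 / sqrt (B x x)" for x
    have pos: "B x x > 0" if "x \<in> set xs" for x using that xs False by (intro B_pos) auto
    have "set (map (\<lambda>x. c x *\<^sub>R x) xs) \<subseteq> ?K" using xs pos by (force simp: c_def B_simps less_imp_le)
    then have "\<bar>F (map (\<lambda>x. c x *\<^sub>R x) xs)\<bar> \<le> F s" using xs by (intro abs) auto
    then have "(F (map (\<lambda>x. c x *\<^sub>R x) xs))\<^sup>2 \<le> (F s)\<^sup>2"
      using power_mono[of "\<bar>F (map (\<lambda>x. c x *\<^sub>R x) xs)\<bar>" "F s" 2] by simp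
    then have 1: "(prod_list (map c xs))\<^sup>2 * (F xs)\<^sup>2 \<le> (F s)\<^sup>2"
      using F.scale_all[of "[]" xs c] xs by (simp add: power_mult_distrib)
    have 2: "(prod_list (map c xs))\<^sup>2 * prod_list (map (\<lambda>x. B x x) xs) = 1 \<and> prod_list (map (\<lambda>x. B x x) xs) > 0"
      using pos
    proof (induction xs)
      case (Cons x xs)
      have "(c x)\<^sup>2 * B x x = 1" using Cons.prems[of x] by (simp add: c_def power2_eq_square)
      moreover have "(prod_list (map c xs))\<^sup>2 * prod_list (map (\<lambda>x. B x x) xs) = 1 \<and> prod_list (map (\<lambda>x. B x x) xs) > 0"
        using Cons.prems by (intro Cons.IH) auto
      moreover have "(prod_list (map c (x # xs)))\<^sup>2 * prod_list (map (\<lambda>x. B x x) (x # xs)) =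
          ((c x)\<^sup>2 * B x x) * ((prod_list (map c xs))\<^sup>2 * prod_list (map (\<lambda>x. B x x) xs))"
        by (simp add: power_mult_distrib)
      ultimately show ?case using Cons.prems[of x] by simp
    qed simp
    have "(F xs)\<^sup>2 = (prod_list (map c xs))\<^sup>2 * (F xs)\<^sup>2 * prod_list (map (\<lambda>x. B x x) xs)"
      using 2 by (simp add: mult.commute mult.left_commute)
    also have "\<dots> \<le> (F s)\<^sup>2 * prod_list (map (\<lambda>x. B x x) xs)"
      using 1 2 by (intro mult_right_mono) auto
    finally show ?thesis .
  qed
  have "F s \<noteq> 0"
  proof
    assume "F s = 0"
    then have "(F (xs0 @ [br xs0]))\<^sup>2 \<le> 0" using bound[of "xs0 @ [br xs0]"] xs0 br0 by simp
    then show False using nz by simp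
  qed
  then show ?thesis using s bound by (intro that[of s]) (auto simp: maximal_frame_def)
qed

section \<open>Brackets of a maximal frame and the ideal it spans\<close>

context
  fixes s assumes s: "maximal_frame s"
begin

lemma frame_length: "mset s = mset xs \<Longrightarrow> length xs = Suc k"
  using s mset_eq_length[of s xs] by (simp add: maximal_frame_def)

lemma frame_perm_F: "mset s = mset xs \<Longrightarrow> \<bar>F xs\<bar> = \<bar>F s\<bar>"
  using F.permute[of s xs] s by (auto simp: maximal_frame_def)

text \<open>Freezing k - 3 entries of the bracket leaves a Lie 3-algebra.\<close>

lemma frozen_lie3:
  assumes "length X + 3 = k" "set X \<subseteq> M" "\<And>x. x \<in> set X \<Longrightarrow> B x x = 1"
  shows "lie3_bounded M B (\<lambda>x y z. br (X @ [x, y, z])) \<bar>F s\<bar>"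
proof unfold_locales
  fix x y z w a b c :: 'v and r :: real
  show "br (X @ [x, y, r *\<^sub>R z + w]) = r *\<^sub>R br (X @ [x, y, z]) + br (X @ [x, y, w])"
    using br.slot_add[of "X @ [x, y]" "[]"] br.slot_scale[of "X @ [x, y]" "[]"] assms(1) by simp
  show "br (X @ [y, x, z]) = - br (X @ [x, y, z])"
    using br.swap[of X "[z]" y x] assms(1) by simp
  show "br (X @ [x, z, y]) = - br (X @ [x, y, z])"
    using br.swap[of "X @ [x]" "[]" z y] assms(1) by simp
  show "0 < \<bar>F s\<bar>" using s by (simp add: maximal_frame_def)
  {
    assume "x \<in> M" "y \<in> M" "z \<in> M"
    then show "br (X @ [x, y, z]) \<in> M" using assms by (intro br_M) auto
  }
  {
    assume M: "x \<in> M" "y \<in> M" "z \<in> M" "w \<in> M"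
    have eq: "B (br (X @ [x, y, z])) w = F (X @ [x, y, z, w])" if "z \<in> M" "w \<in> M" for z w
      using F_eq[of "X @ [x, y, z]" w] M that assms by simp
    show "B (br (X @ [x, y, z])) w = - B (br (X @ [x, y, w])) z"
      using F.swap[of "X @ [x, y]" "[]" z w] M assms by (simp add: eq)
    have "(F (X @ [x, y, z, w]))\<^sup>2 \<le> (F s)\<^sup>2 * prod_list (map (\<lambda>x. B x x) (X @ [x, y, z, w]))"
      using s M assms(1,2) unfolding maximal_frame_def by (metis (no_types, lifting) append.simps length_append length_Cons list.size(3) add_Suc_right numeral_3_eq_3 set_append insert_subset list.set(1,2) Un_subset_iff empty_subsetI)
    moreover have "prod_list (map (\<lambda>x. B x x) X) = 1" using assms(3) by (induction X) auto
    ultimately show "(B (br (X @ [x, y, z])) w)\<^sup>2 \<le> \<bar>F s\<bar>\<^sup>2 * B x x * B y y * B z z * B w w"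
      using M by (simp add: eq mult.assoc)
  }
  {
    assume M: "x \<in> M" "y \<in> M" "a \<in> M" "b \<in> M" "c \<in> M"
    let ?d = "\<lambda>u. br (X @ [x, y, u])"
    let ?ys = "X @ [a, b, c]"
    have k: "k = Suc (Suc (Suc (length X)))" using assms(1) by simp
    have "?d (br ?ys) = (\<Sum>i<k. br (?ys[i := ?d (?ys ! i)]))"
      using br_FI[of "X @ [x, y]" ?ys] M assms by simp
    also have "\<dots> = (\<Sum>i<length X. br (?ys[i := ?d (?ys ! i)])) + br (X @ [?d a, b, c]) +
        br (X @ [a, ?d b, c]) + br (X @ [a, b, ?d c])"
      unfolding k by (simp add: list_update_append nth_append)
    also have "(\<Sum>i<length X. br (?ys[i := ?d (?ys ! i)])) = 0"
    proof (rule sum.neutral, rule ballI)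
      fix i assume i: "i \<in> {..<length X}"
      have "?d (?ys ! i) = 0"
        using i assms(1) by (intro br.vanish) (auto simp: nth_append)
      moreover have "?ys[i := 0] = take i X @ 0 # (drop (Suc i) X @ [a, b, c])"
        using i by (simp add: upd_conv_take_nth_drop list_update_append)
      ultimately show "br (?ys[i := ?d (?ys ! i)]) = 0"
        using i assms(1) by (simp add: br.slot_0)
    qed
    finally show "?d (br ?ys) = br (X @ [?d a, b, c]) + br (X @ [a, ?d b, c]) + br (X @ [a, b, ?d c])"
      by simp
  }
qed

text \<open>In any ordering of s, freezing X makes (p, h, e, f) a maximiser of a Lie 3-algebra up to
  sign, so the results on maximisers transfer.\<close>

lemma frame_split:
  assumes "mset s = mset (X @ [p, h, e, f])"
  shows "\<And>w. w \<in> M \<Longrightarrow> (\<And>x. x \<in> set s \<Longrightarrow> B x w = 0) \<Longrightarrow> br (X @ [p, h, w]) = 0"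
    and "br (X @ [p, h, e]) = F (X @ [p, h, e, f]) *\<^sub>R f"
    and "B e f = 0"
proof -
  have len: "length X + 3 = k" using frame_length[OF assms] by simp
  have set: "set s = set (X @ [p, h, e, f])" using assms mset_eq_setD by blast
  have M: "set X \<subseteq> M" "p \<in> M" "h \<in> M" "e \<in> M" "f \<in> M" using s set by (auto simp: maximal_frame_def)
  have n: "\<And>x. x \<in> set X \<Longrightarrow> B x x = 1" "B p p = 1" "B h h = 1" "B e e = 1" "B f f = 1"
    using s set by (auto simp: maximal_frame_def)
  interpret l3: lie3_bounded M B "\<lambda>x y z. br (X @ [x, y, z])" "\<bar>F s\<bar>"
    by (rule frozen_lie3) (use len M n in auto)
  \<comment> \<open>A maximiser needs the positive value \<open>\<bar>F s\<bar>\<close>; \<sigma>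
    carries the sign of \<open>F\<close> at this ordering and is absorbed into f.\<close>
  define \<sigma> where "\<sigma> = (if F (X @ [p, h, e, f]) > 0 then 1 else -1 :: real)"
  have F: "F (X @ [p, h, e, f]) = \<sigma> * \<bar>F s\<bar>" "\<sigma> * \<sigma> = 1"
    using frame_perm_F[OF assms] by (auto simp: \<sigma>_def)
  have "B (br (X @ [p, h, e])) f = \<sigma> * \<bar>F s\<bar>"
    using F_eq[of "X @ [p, h, e]" f] M len F by simp
  then have mx: "l3.maximiser p h e (\<sigma> *\<^sub>R f)"
    using M n F by (auto simp: l3.maximiser_def B_simps)
  show "br (X @ [p, h, w]) = 0" if "w \<in> M" "\<And>x. x \<in> set s \<Longrightarrow> B x w = 0" for w
    using that set by (intro l3.maximiser_rotation_vanishes[OF mx]) (auto simp: l3.perp_def B_simps)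
  show "br (X @ [p, h, e]) = F (X @ [p, h, e, f]) *\<^sub>R f"
    using l3.maximiser_first_order(1)[OF mx] F by (simp add: mult.commute)
  show "B e f = 0" using l3.maximiser_orthogonal(6)[OF mx] F by (auto simp: B_simps)
qed

lemma frame_split_exists:
  assumes "mset s = mset (ys @ [e, f])"
  obtains X p h where "ys = X @ [p, h]"
proof -
  have "length ys \<ge> 2" using frame_length[OF assms] k3 by simp
  then have "length (ys @ [e]) \<ge> 3" by simp
  then obtain X a b c where "ys @ [e] = X @ [a, b, c]" by (rule list_split_last3)
  then have "ys = X @ [a, b]" by (metis append.assoc append1_eq_conv append_Cons append_Nil)
  then show ?thesis using that by blast
qed

lemma frame_bracket:
  assumes "mset s = mset (ss @ [a])"
  shows "br ss = F (ss @ [a]) *\<^sub>R a"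
proof -
  have "length ss = k" using frame_length[OF assms] by simp
  then obtain X p h e where "ss = X @ [p, h, e]" using k3 list_split_last3[of ss] by metis
  then show ?thesis using frame_split(2)[of X p h e a] assms by simp
qed

lemma frame_orthonormal:
  assumes "x \<in> set s" "y \<in> set s" shows "B x y = (if x = y then 1 else 0)"
proof (cases "x = y")
  case True
  then show ?thesis using s assms by (auto simp: maximal_frame_def)
next
  case False
  obtain zs where zs: "mset s = mset (zs @ [y])" using mset_split_last[OF assms(2)] by blast
  then have "x \<in> set zs" using False assms(1) mset_eq_setD[OF zs] by auto
  from mset_split_last[OF this] obtain ys where "mset zs = mset (ys @ [x])" .
  then have ms: "mset s = mset (ys @ [x, y])" using zs by simp
  from frame_split_exists[OF ms] obtain X p h where "ys = X @ [p, h]" .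
  then show ?thesis using frame_split(3)[of X p h x y] ms False by simp
qed

lemma frame_distinct: "distinct s"
  using s F.vanish[of s] by (auto simp: maximal_frame_def)

lemma frame_spanI:
  assumes "y \<in> M" "\<And>w. w \<in> M \<Longrightarrow> (\<And>a. a \<in> set s \<Longrightarrow> B a w = 0) \<Longrightarrow> B y w = 0"
  shows "y \<in> span (set s)"
  using assms frame_orthonormal s by (intro in_span_orthonormal) (auto simp: maximal_frame_def)

text \<open>The other k - 1 entries are frame vectors, so their bracket with any w orthogonal to the
  frame vanishes; exchanging x and w in \<open>F\<close> makes \<open>br (ss[i := x])\<close>
  orthogonal to every such w.\<close>

lemma frame_bracket_replace:
  assumes ss: "mset s = mset (ss @ [a])" and i: "i < k" and x: "x \<in> M"
  shows "br (ss[i := x]) \<in> span (set s)"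
proof (rule frame_spanI)
  have len: "length ss = k" using frame_length[OF ss] by simp
  have set: "set s = set (ss @ [a])" using ss mset_eq_setD by blast
  then have M: "set ss \<subseteq> M" using s by (auto simp: maximal_frame_def)
  define us where "us = take i ss"
  define vs where "vs = drop (Suc i) ss"
  have upd: "ss[i := x] = us @ x # vs" using i len by (simp add: us_def vs_def upd_conv_take_nth_drop)
  have ss_eq: "ss = us @ ss ! i # vs" using i len by (simp add: us_def vs_def id_take_nth_drop)
  have sub: "set us \<subseteq> M" "set vs \<subseteq> M" using M by (auto simp: us_def vs_def dest: in_set_takeD in_set_dropD)
  have l: "Suc (length us + length vs) = k" using len ss_eq by (metis length_append length_Cons add_Suc_right)
  show xM: "br (ss[i := x]) \<in> M" using sub x l by (intro br_M) (auto simp: upd)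
  fix w assume w: "w \<in> M" "\<And>a. a \<in> set s \<Longrightarrow> B a w = 0"
  have ms: "mset s = mset ((us @ vs) @ [ss ! i, a])"
    using ss by (subst (asm) ss_eq) simp
  from frame_split_exists[OF ms] obtain X p h where X: "us @ vs = X @ [p, h]" .
  have "br ((us @ vs) @ [w]) = 0"
    using frame_split(1)[of X p h "ss ! i" a w] ms w unfolding X by simp
  then have "F (us @ vs @ [w, x]) = 0"
    using F_eq[of "us @ vs @ [w]" x] sub l w x by (auto simp: B_zero)
  moreover have "B (br (ss[i := x])) w = F (us @ x # vs @ [w])"
    using F_eq[of "us @ x # vs" w] sub l w x by (simp add: upd)
  moreover have "mset (us @ x # vs @ [w]) = mset (us @ vs @ [w, x])" by simp
  ultimately show "B (br (ss[i := x])) w = 0"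
    using F.permute[of "us @ x # vs @ [w]" "us @ vs @ [w, x]"] l by simp
qed

text \<open>Up to the nonzero factor \<mu>, a is the bracket of the other frame vectors, so the
  fundamental identity reduces the claim to brackets in which one frame vector is replaced.\<close>

lemma frame_ideal_last:
  assumes zs: "length zs = k - 1" "set zs \<subseteq> M" and a: "a \<in> set s"
  shows "br (zs @ [a]) \<in> span (set s)"
proof -
  obtain ss where ss: "mset s = mset (ss @ [a])" using mset_split_last[OF a] by blast
  have len: "length ss = k" using frame_length[OF ss] by simp
  have "set s = set (ss @ [a])" using ss mset_eq_setD by blast
  then have M: "set ss \<subseteq> M" using s by (auto simp: maximal_frame_def)
  define \<mu> where "\<mu> = F (ss @ [a])"
  have \<mu>: "\<mu> \<noteq> 0" using frame_perm_F[OF ss] s by (auto simp: \<mu>_def maximal_frame_def)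
  have "br (zs @ [br ss]) = (\<Sum>i<k. br (ss[i := br (zs @ [ss ! i])]))"
    using zs len M by (intro br_FI)
  also have "\<dots> \<in> span (set s)"
    using zs len M k3 by (intro span_sum frame_bracket_replace[OF ss] br_M) auto
  finally have "\<mu> *\<^sub>R br (zs @ [a]) \<in> span (set s)"
    using frame_bracket[OF ss] br.slot_scale[of zs "[]" \<mu> a] zs k3 by (simp add: \<mu>_def)
  from span_scale[OF this, of "1 / \<mu>"] show ?thesis using \<mu> by simp
qed

theorem frame_ideal:
  assumes xs: "length xs = k" "set xs \<subseteq> M" "a \<in> set xs" "a \<in> set s"
  shows "br xs \<in> span (set s)"
proof -
  obtain zs where zs: "mset xs = mset (zs @ [a])" using mset_split_last[OF xs(3)] by blast
  then have "br (zs @ [a]) \<in> span (set s)"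
    using xs mset_eq_length[OF zs] mset_eq_setD[OF zs] by (intro frame_ideal_last) auto
  then show ?thesis using br.permute[OF zs xs(1)] span_neg[of "br (zs @ [a])"] by auto
qed

end
end

text \<open>Negating one vector reverses the sign of \<open>F\<close>. The chosen sign is the one
  matching the brackets \<open>(-1) ^ i\<close> of the model.\<close>

lemma (in euclidean_lie_k) maximal_frame_oriented:
  assumes "length xs = k" "set xs \<subseteq> M" "br xs \<noteq> 0"
  obtains s where "maximal_frame s" "0 < (-1) ^ Suc k * F s"
proof -
  obtain s where s: "maximal_frame s" using maximal_frame_exists[OF assms] .
  then obtain y ys where y: "s = y # ys" by (cases s) (auto simp: maximal_frame_def)
  have F: "F (- y # ys) = - F s" using F.slot_neg[of "[]" ys y] s y by (simp add: maximal_frame_def)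
  then have s': "maximal_frame (- y # ys)" using s unfolding maximal_frame_def y by (auto simp: B_simps)
  have "(-1) ^ Suc k * F s \<noteq> 0" using s by (simp add: maximal_frame_def)
  then consider "0 < (-1) ^ Suc k * F s" | "0 < (-1) ^ Suc k * F (- y # ys)" unfolding F by fastforce
  then show ?thesis using that[OF s] that[OF s'] by cases
qed

section \<open>Splitting off the span of a maximal frame\<close>

context euclidean_lie_k begin

context
  fixes s assumes s: "maximal_frame s"
begin

definition frame_perp :: "'v set" where "frame_perp = {w \<in> M. \<forall>a\<in>set s. B a w = 0}"

lemma frame_subset: "set s \<subseteq> M" using s by (simp add: maximal_frame_def)

lemma subspace_frame_perp: "subspace frame_perp"
  by (auto simp: subspace_def frame_perp_def B_simps)

lemma frame_decomposition:
  assumes "z \<in> M" obtains p where "p \<in> span (set s)" "z - p \<in> frame_perp"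
proof -
  obtain p where "p \<in> span (set s)" "p \<in> M" "\<And>a. a \<in> set s \<Longrightarrow> B a (z - p) = 0"
    using orthonormal_decomposition[of "set s" z] frame_orthonormal[OF s] frame_subset by auto
  then show ?thesis using assms by (intro that[of p]) (auto simp: frame_perp_def)
qed

lemma bracket_perp_orthogonal:
  assumes xs: "length xs = k" "set xs \<subseteq> M" "w \<in> set xs" "w \<in> frame_perp" and a: "a \<in> set s"
  shows "B (br xs) a = 0"
proof -
  obtain zs where zs: "mset xs = mset (zs @ [w])" using mset_split_last[OF xs(3)] .
  have l: "Suc (length zs) = k" using mset_eq_length[OF zs] xs by simp
  have z: "set zs \<subseteq> M" "w \<in> M" using mset_eq_setD[OF zs] xs by auto
  have aM: "a \<in> M" using a frame_subset by auto
  have "br (zs @ [a]) \<in> span (set s)" using l z aM a by (intro frame_ideal[OF s]) auto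
  then have "B (br (zs @ [a])) w = 0"
    by (rule span_orthogonal) (use xs(4) in \<open>auto simp: frame_perp_def\<close>)
  then have "F (zs @ [a, w]) = 0" using F_eq[of "zs @ [a]" w] l z aM by simp
  moreover have "B (br xs) a = F (xs @ [a])" using F_eq xs aM by simp
  moreover have "mset (xs @ [a]) = mset (zs @ [a, w])" using zs by simp
  ultimately show ?thesis using F.permute[of "xs @ [a]" "zs @ [a, w]"] xs by simp
qed

text \<open>The bracket lies in the span of s by \<open>frame_ideal\<close> and is orthogonal to it
  by \<open>bracket_perp_orthogonal\<close>.\<close>

lemma bracket_mixed:
  assumes xs: "length xs = k" "set xs \<subseteq> M" "w \<in> set xs" "w \<in> frame_perp" "a \<in> set xs" "a \<in> set s"
  shows "br xs = 0"
proof -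
  have "br xs \<in> span (set s)" using frame_ideal[OF s xs(1,2,5,6)] .
  then have "B (br xs) (br xs) = 0"
    by (rule span_orthogonal) (use bracket_perp_orthogonal[OF xs(1-4)] B_sym in metis)
  then show ?thesis using B_eq_0_iff br_M xs by auto
qed

lemma euclidean_lie_k_frame_perp: "euclidean_lie_k frame_perp B k br F"
proof unfold_locales
  show "subspace frame_perp" by (rule subspace_frame_perp)
  show "br xs \<in> frame_perp" if xs: "length xs = k" "set xs \<subseteq> frame_perp" for xs
  proof -
    obtain w where w: "w \<in> set xs" using xs k3 by (cases xs) auto
    have M: "set xs \<subseteq> M" using xs by (auto simp: frame_perp_def)
    have "w \<in> frame_perp" using w xs by auto
    then show ?thesis
      using bracket_perp_orthogonal[OF xs(1) M w] br_M[OF xs(1) M] B_sym by (auto simp: frame_perp_def)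
  qed
  have sub: "frame_perp \<subseteq> M" by (auto simp: frame_perp_def)
  show "0 < B x x" if "x \<in> frame_perp" "x \<noteq> 0" for x using that sub B_pos by auto
  show "F (xs @ [z]) = B (br xs) z" if "length xs = k" "set xs \<subseteq> frame_perp" "z \<in> frame_perp" for xs z
    using that sub by (intro F_eq) auto
  show "br (xs @ [br ys]) = (\<Sum>i<k. br (ys[i := br (xs @ [ys ! i])]))"
    if "length xs = k - 1" "set xs \<subseteq> frame_perp" "length ys = k" "set ys \<subseteq> frame_perp" for xs ys
    using that sub by (intro br_FI) auto
qed (auto simp: B_sym B_simps k3)

text \<open>An element central in the complement is central in M, because its brackets with frame
  vectors vanish by \<open>bracket_mixed\<close>.\<close>

lemma centerless_frame_perp:
  assumes nc: "\<And>x. x \<in> M \<Longrightarrow> (\<And>ys. length ys = k - 1 \<Longrightarrow> set ys \<subseteq> M \<Longrightarrow> br (x # ys) = 0) \<Longrightarrow> x = 0"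
    and x: "x \<in> frame_perp" "\<And>ys. length ys = k - 1 \<Longrightarrow> set ys \<subseteq> frame_perp \<Longrightarrow> br (x # ys) = 0"
  shows "x = 0"
proof (rule nc)
  show xM: "x \<in> M" using x by (auto simp: frame_perp_def)
  \<comment> \<open>Entries are decomposed one at a time: ps already lies in the complement, zs is
    still arbitrary.\<close>
  have "br (x # ps @ zs) = 0" if "length ps + length zs = k - 1" "set ps \<subseteq> frame_perp" "set zs \<subseteq> M" for ps zs
    using that
  proof (induction zs arbitrary: ps)
    case Nil
    then show ?case using x(2)[of ps] by simp
  next
    case (Cons z zs)
    then obtain p where p: "p \<in> span (set s)" "z - p \<in> frame_perp" using frame_decomposition[of z] by auto
    have l: "length (x # ps) + length zs + 1 = k" using Cons.prems k3 by simp
    note lin = br.linear_slot[OF l]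
    have sub: "set (x # ps @ zs) \<subseteq> M" using Cons.prems xM by (auto simp: frame_perp_def)
    have "subspace {y. br ((x # ps) @ y # zs) = 0}" 
      using linear_subspace_kernel[OF lin] by simp
    moreover have "set s \<subseteq> {y. br ((x # ps) @ y # zs) = 0}"
    proof
      fix a assume a: "a \<in> set s"
      have "br ((x # ps) @ a # zs) = 0"
        using l sub frame_subset a x(1) by (intro bracket_mixed[of _ x a]) auto
      then show "a \<in> {y. br ((x # ps) @ y # zs) = 0}" by simp
    qed
    ultimately have "br ((x # ps) @ p # zs) = 0" using p(1) span_minimal by blast
    moreover have "br (x # (ps @ [z - p]) @ zs) = 0"
      using Cons.prems p by (intro Cons.IH) auto
    ultimately show ?case using linear_diff[OF lin, of z p] by simp
  qed
  from this[of "[]"] show "br (x # ys) = 0" if "length ys = k - 1" "set ys \<subseteq> M" for ys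
    using that by simp
qed

lemma dim_frame_perp: "dim frame_perp < dim M"
proof (rule dim_psubset)
  obtain a where a: "a \<in> set s" using s by (cases s) (auto simp: maximal_frame_def)
  have "a \<in> M" "a \<notin> frame_perp"
    using a frame_subset frame_orthonormal[OF s a a] by (fastforce simp: frame_perp_def)+
  moreover have "frame_perp \<subseteq> M" by (auto simp: frame_perp_def)
  ultimately have "frame_perp \<subset> M" by blast
  then show "span frame_perp \<subset> span M"
    by (simp only: span_eq_iff[THEN iffD2, OF subspace_frame_perp] span_eq_iff[THEN iffD2, OF sub])
qed

text \<open>Rescaling by r turns the structure constant F s into \<open>\<plusminus>1\<close> because the bracket has degree k.\<close>

lemma frame_simple_block:
  assumes pos: "0 < (-1) ^ Suc k * F s"
  obtains r where "0 < r"
    "\<And>i. i \<in> {1..k+1} \<Longrightarrow>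
      br (map (\<lambda>i. r *\<^sub>R s ! (i - 1)) ([1..<i] @ [Suc i..<k+2])) = (-1) ^ i *\<^sub>R r *\<^sub>R s ! (i - 1)"
proof -
  define l where "l = (-1) ^ Suc k * F s"
  \<comment> \<open>Scaling puts \<open>r ^ k\<close> on the bracket side and r on the other, so r
    must solve \<open>r ^ k * l = r\<close>.\<close>
  define r where "r = root (k - 1) (1 / l)"
  have l: "l > 0" "F s = (-1) ^ Suc k * l" using pos by (auto simp: l_def simp flip: power_add mult_2)
  have len: "length s = Suc k" using s by (simp add: maximal_frame_def)
  have r: "r > 0" "r ^ (k - 1) = 1 / l" using l k3 by (auto simp: r_def)
  have rk: "r ^ k * l = r"
  proof -
    have "r ^ k = r * r ^ (k - 1)" using k3 by (metis power_Suc Suc_diff_1 less_le_trans zero_less_numeral)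
    then show ?thesis using r l by simp
  qed
  show ?thesis
  proof (rule that[OF r(1)])
    fix i assume i: "i \<in> {1..k+1}"
    define a where "a = s ! (i - 1)"
    define us where "us = take (i - 1) s"
    define vs where "vs = drop i s"
    have s_eq: "s = us @ a # vs"
    proof -
      have "i - 1 < length s" "Suc (i - 1) = i" using i len by auto
      then show ?thesis using id_take_nth_drop[of "i - 1" s] by (simp add: us_def vs_def a_def)
    qed
    have "map (\<lambda>i. s ! (i - 1)) ([1..<i] @ [Suc i..<k+2]) = us @ vs"
    proof -
      have "map (\<lambda>i. s ! (i - 1)) [1..<i] = us"
        using i len by (intro nth_equalityI) (auto simp: us_def)
      moreover have "map (\<lambda>i. s ! (i - 1)) [Suc i..<k+2] = vs"
        using i len by (intro nth_equalityI) (auto simp: vs_def simp del: upt_Suc)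
      ultimately show ?thesis by simp
    qed
    then have map: "map (\<lambda>i. r *\<^sub>R s ! (i - 1)) ([1..<i] @ [Suc i..<k+2]) = map (\<lambda>x. r *\<^sub>R x) (us @ vs)"
      by (metis (no_types, lifting) List.map.compositionality comp_apply map_eq_conv)
    have l2: "length us + length vs = k" "length vs = Suc k - i" using s_eq len i by (auto simp: us_def vs_def)
    have "br (map (\<lambda>x. r *\<^sub>R x) (us @ vs)) = r ^ k *\<^sub>R br (us @ vs)"
      using br.scale_all[of "[]" "us @ vs" "\<lambda>_. r"] l2(1)
      by (simp add: map_replicate_const flip: power_add)
    also have "br (us @ vs) = F (us @ vs @ [a]) *\<^sub>R a"
      using frame_bracket[OF s, of "us @ vs" a] s_eq by simp
    \<comment> \<open>Moving a from position i to the end passes the \<open>Suc k - i\<close>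
      entries of vs.\<close>
    also have "F (us @ vs @ [a]) = (-1) ^ (Suc k - i) * F s"
      using F.move[of us vs "[]" a] l2 s_eq by simp
    also have "(-1) ^ (Suc k - i) * F s = (-1) ^ i * l"
    proof -
      have "(-1::real) ^ (Suc k - i) * (-1) ^ Suc k = (-1) ^ i"
        using i by (auto simp: minus_one_power_iff)
      then show ?thesis using l(2) by (metis mult.assoc)
    qed
    also have "r ^ k *\<^sub>R ((-1) ^ i * l) *\<^sub>R a = (-1) ^ i *\<^sub>R (r ^ k * l) *\<^sub>R a" by simp
    finally show "br (map (\<lambda>i. r *\<^sub>R s ! (i - 1)) ([1..<i] @ [Suc i..<k+2])) = (-1) ^ i *\<^sub>R r *\<^sub>R s ! (i - 1)"
      using rk map by (simp only: a_def)
  qed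
qed

text \<open>The new summand becomes block number m, with vectors r times the frame and scale
  \<open>r * r\<close>; \<open>bracket_mixed\<close> kills its brackets with older blocks.\<close>

lemma iso_sum_simple_extend:
  assumes pos: "0 < (-1) ^ Suc k * F s" and iso: "iso_sum_simple frame_perp k br B m"
  shows "iso_sum_simple M k br B (Suc m)"
proof -
  obtain r where r: "0 < r"
    "\<And>i. i \<in> {1..k+1} \<Longrightarrow>
      br (map (\<lambda>i. r *\<^sub>R s ! (i - 1)) ([1..<i] @ [Suc i..<k+2])) = (-1) ^ i *\<^sub>R r *\<^sub>R s ! (i - 1)"
    by (rule frame_simple_block[OF pos]) blast
  let ?I = "\<lambda>m. {..<m} \<times> {1..k+1}"
  obtain e c where e: "inj_on (\<lambda>(j, i). e j i) (?I m) \<and> (\<lambda>(j, i). e j i) ` ?I m \<subseteq> frame_perp \<and>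
    independent ((\<lambda>(j, i). e j i) ` ?I m) \<and> span ((\<lambda>(j, i). e j i) ` ?I m) = frame_perp \<and>
    (\<forall>j<m. 0 < c j) \<and>
    (\<forall>p\<in>?I m. \<forall>q\<in>?I m. B (case_prod e p) (case_prod e q) = (if p = q then c (fst p) else 0)) \<and>
    (\<forall>j<m. \<forall>i\<in>{1..k+1}. br (map (e j) ([1..<i] @ [Suc i..<k+2])) = (-1) ^ i *\<^sub>R e j i) \<and>
    (\<forall>ps. length ps = k \<and> set ps \<subseteq> ?I m \<and> (\<exists>p\<in>set ps. \<exists>q\<in>set ps. fst p \<noteq> fst q) \<longrightarrow>
      br (map (case_prod e) ps) = 0)"
    using iso unfolding iso_sum_simple_def Let_def by (elim exE)
  note e = e[THEN conjunct2, THEN conjunct1] e[THEN conjunct2, THEN conjunct2, THEN conjunct2]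
  note e = e(1) e(2)[THEN conjunct1] e(2)[THEN conjunct2]
  note e = e(1,2) e(3)[THEN conjunct1, rule_format] e(3)[THEN conjunct2, THEN conjunct1, rule_format]
    e(3)[THEN conjunct2, THEN conjunct2, THEN conjunct1, rule_format]
    e(3)[THEN conjunct2, THEN conjunct2, THEN conjunct2, rule_format]
  have len: "length s = Suc k" using s by (simp add: maximal_frame_def)
  define e' where "e' j i = (if j < m then e j i else r *\<^sub>R s ! (i - 1))" for j i
  define c' where "c' j = (if j < m then c j else r * r)" for j
  let ?E = "(\<lambda>(j, i). e' j i) ` ?I (Suc m)"
  have old: "e' j i \<in> frame_perp" if "j < m" "i \<in> {1..k+1}" for j i
    using e(1) that by (force simp: e'_def)
  have sin: "s ! (i - 1) \<in> set s" if "i \<in> {1..k+1}" for i using that len by auto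
  have perpM: "frame_perp \<subseteq> M" by (auto simp: frame_perp_def)
  have EM: "?E \<subseteq> M"
  proof -
    have "e' j i \<in> M" if "i \<in> {1..k+1}" for i j
      using old[of j i] that sin[OF that] frame_subset perpM by (cases "j < m") (auto simp: e'_def)
    then show ?thesis by auto
  qed
  have gram: "B (case_prod e' p) (case_prod e' q) = (if p = q then c' (fst p) else 0)"
    if pq: "p \<in> ?I (Suc m)" "q \<in> ?I (Suc m)" for p q
  proof -
    obtain j i j' i' where p: "p = (j, i)" "q = (j', i')" by fastforce
    have b: "j < Suc m" "i \<in> {1..k+1}" "j' < Suc m" "i' \<in> {1..k+1}" using pq p by auto
    consider "j < m" "j' < m" | "j = m" "j' < m" | "j < m" "j' = m" | "j = m" "j' = m" using b by linarith
    then show ?thesis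
    proof cases
      case 1
      then show ?thesis using e(4)[of p q] b p by (auto simp: e'_def c'_def)
    next
      case 2
      then show ?thesis using old[of j' i'] b p sin[of i] by (auto simp: e'_def B_simps frame_perp_def)
    next
      case 3
      then show ?thesis using old[of j i] b p sin[of i'] B_sym by (auto simp: e'_def B_simps frame_perp_def)
    next
      case 4
      have "s ! (i - 1) = s ! (i' - 1) \<longleftrightarrow> i = i'"
        using nth_eq_iff_index_eq[OF frame_distinct[OF s], of "i - 1" "i' - 1"] b len
        by (metis One_nat_def Suc_eq_plus1 Suc_le_mono Suc_pred atLeastAtMost_iff less_Suc_eq_le not_less_eq_eq not_less0 zero_less_iff_neq_zero zero_neq_one le_zero_eq)
      then show ?thesis using 4 b p frame_orthonormal[OF s sin sin, of i i'] by (auto simp: e'_def B_simps c'_def)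
    qed
  qed
  have c': "0 < c' j" if "j < Suc m" for j using that e(3) r(1) by (auto simp: c'_def)
  have pos': "B (case_prod e' p) (case_prod e' p) > 0" if "p \<in> ?I (Suc m)" for p
    using gram[OF that that] c' that by auto
  have inj: "inj_on (\<lambda>(j, i). e' j i) (?I (Suc m))"
  proof (rule inj_onI, rule ccontr)
    fix p q assume "p \<in> ?I (Suc m)" "q \<in> ?I (Suc m)" "case_prod e' p = case_prod e' q" "p \<noteq> q"
    then show False using gram[of p q] pos'[of p] by auto
  qed
  have ind: "independent ?E"
    by (rule independent_orthogonal) (use gram pos' in \<open>fastforce+\<close>)
  have span: "span ?E = M"
  proof
    show "span ?E \<subseteq> M" using EM sub by (rule span_minimal)
    have "(\<lambda>(j, i). e j i) ` ?I m \<subseteq> ?E" by (force simp: e'_def)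
    then have 1: "frame_perp \<subseteq> span ?E" using e(2) span_mono by blast
    have "a \<in> span ?E" if a: "a \<in> set s" for a
    proof -
      obtain i where i: "i < Suc k" "a = s ! i" using a len by (metis in_set_conv_nth)
      have "e' m (Suc i) \<in> ?E" using i by force
      from span_scale[OF span_base[OF this], of "1 / r"] show ?thesis using r i by (simp add: e'_def)
    qed
    then have 2: "span (set s) \<subseteq> span ?E" using span_minimal[of "set s" "span ?E"] by auto
    show "M \<subseteq> span ?E"
    proof
      fix z assume "z \<in> M"
      then obtain p where "p \<in> span (set s)" "z - p \<in> frame_perp" by (rule frame_decomposition)
      then have "p + (z - p) \<in> span ?E" using 1 2 by (intro span_add) auto
      then show "z \<in> span ?E" by simp
    qed
  qed
  have block: "br (map (e' j) ([1..<i] @ [Suc i..<k+2])) = (-1) ^ i *\<^sub>R e' j i"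
    if "j < Suc m" "i \<in> {1..k+1}" for j i
  proof (cases "j < m")
    case True
    then have "e' j = e j" by (auto simp: e'_def)
    then show ?thesis using e(5)[OF True that(2)] by simp
  next
    case False
    then have "e' j = (\<lambda>i. r *\<^sub>R s ! (i - 1))" by (auto simp: e'_def)
    then show ?thesis using r(2)[OF that(2)] by simp
  qed
  have mixed: "br (map (case_prod e') ps) = 0"
    if ps: "length ps = k" "set ps \<subseteq> ?I (Suc m)" "\<exists>p\<in>set ps. \<exists>q\<in>set ps. fst p \<noteq> fst q" for ps
  proof (cases "\<exists>p\<in>set ps. fst p = m")
    case False
    then have "set ps \<subseteq> ?I m" using ps(2) by fastforce
    moreover from this have "map (case_prod e') ps = map (case_prod e) ps" by (auto simp: e'_def)
    ultimately show ?thesis using e(6)[of ps] ps by presburger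
  next
    case True
    then obtain p where p: "p \<in> set ps" "fst p = m" by blast
    obtain q where q: "q \<in> set ps" "fst q \<noteq> m" using ps(3) by metis
    obtain i where i: "p = (m, i)" "i \<in> {1..k+1}" using p ps(2) by (cases p) auto
    obtain j i' where j: "q = (j, i')" "i' \<in> {1..k+1}" "j < m" using q ps(2) by (cases q) auto
    obtain us vs where uv: "ps = us @ p # vs" using p(1) by (meson split_list)
    let ?xs = "map (case_prod e') us @ s ! (i - 1) # map (case_prod e') vs"
    have "br (map (case_prod e') ps) = r *\<^sub>R br ?xs"
      using br.slot_scale[of "map (case_prod e') us" "map (case_prod e') vs"] ps(1) uv i by (simp add: e'_def)
    also have "br ?xs = 0"
    proof (rule bracket_mixed)
      show "length ?xs = k" using ps(1) uv by simp
      have "case_prod e' ` set ps \<subseteq> M" using ps(2) EM by auto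
      then show "set ?xs \<subseteq> M" using uv sin[OF i(2)] frame_subset by auto
      show "e' j i' \<in> frame_perp" using old j by simp
      have "q \<in> set us \<union> set vs" using q j i uv by auto
      then show "e' j i' \<in> set ?xs" using j by force
      show "s ! (i - 1) \<in> set ?xs" "s ! (i - 1) \<in> set s" using sin[OF i(2)] by auto
    qed
    finally show ?thesis by simp
  qed
  show ?thesis
    unfolding iso_sum_simple_def Let_def
    using inj EM ind span c' gram block mixed by (intro exI[of _ e'] exI[of _ c'] conjI) auto
qed

end
end

text \<open>Induction on the dimension: a nonzero vector is not central, so some bracket is nonzero
  and a maximal frame exists; its complement is again centerless. The zero space is the empty
  sum.\<close>

theorem centerless_iso_sum_simple:
  assumes "euclidean_lie_k M B k br F"
    and "\<And>x. x \<in> M \<Longrightarrow> (\<And>ys. length ys = k - 1 \<Longrightarrow> set ys \<subseteq> M \<Longrightarrow> br (x # ys) = 0) \<Longrightarrow> x = 0"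
  shows "\<exists>m. iso_sum_simple M k br B m"
  using assms
proof (induction "dim M" arbitrary: M rule: less_induct)
  case less
  interpret euclidean_lie_k M B k br F by fact
  show ?case
  proof (cases "M = {0}")
    case True
    then have "iso_sum_simple M k br B 0" using k3 by (auto simp: iso_sum_simple_def Let_def independent_empty)
    then show ?thesis by blast
  next
    case False
    then obtain x where "x \<in> M" "x \<noteq> 0" using M_closed(1) by blast
    then obtain ys where ys: "length ys = k - 1" "set ys \<subseteq> M" "br (x # ys) \<noteq> 0"
      using less.prems(2) by blast
    obtain s where s: "maximal_frame s" "0 < (-1) ^ Suc k * F s"
      using maximal_frame_oriented[of "x # ys"] ys \<open>x \<in> M\<close> k3 by auto
    have "\<exists>m. iso_sum_simple (frame_perp s) k br B m"
      using centerless_frame_perp[OF s(1) less.prems(2)]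
      by (intro less.hyps dim_frame_perp[OF s(1)] euclidean_lie_k_frame_perp[OF s(1)]) blast+
    then show ?thesis using iso_sum_simple_extend[OF s] by blast
  qed
qed

section \<open>Alternating maps: fixing an entry, linear images, generators\<close>

lemma alternating_map_Cons:
  fixes f :: "'v::euclidean_space list \<Rightarrow> 'w::real_normed_vector"
  assumes "alternating_map (Suc m) f"
  shows "alternating_map m (\<lambda>xs. f (u # xs))"
proof
  interpret alternating_map "Suc m" f by fact
  show "multilinear_on UNIV m (\<lambda>xs. f (u # xs))"
    unfolding multilinear_on_def
  proof (intro allI impI)
    fix xs :: "'v list" and i and x y :: 'v and a b :: real
    assume "length xs = m \<and> set xs \<subseteq> UNIV \<and> i < m \<and> x \<in> UNIV \<and> y \<in> UNIV"
    then show "f (u # xs[i := a *\<^sub>R x + b *\<^sub>R y]) = a *\<^sub>R f (u # xs[i := x]) + b *\<^sub>R f (u # xs[i := y])"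
      using multilin[unfolded multilinear_on_def, rule_format, of "u # xs" "Suc i" x y a b] by simp
  qed
  show "alternating_on UNIV m (\<lambda>xs. f (u # xs))"
    unfolding alternating_on_def by (auto intro!: vanish)
qed

lemma alternating_map_linear:
  assumes "alternating_map m f" "linear g"
  shows "alternating_map m (\<lambda>xs. g (f xs))"
proof
  interpret alternating_map m f by fact
  show "multilinear_on UNIV m (\<lambda>xs. g (f xs))"
    using multilin by (simp add: multilinear_on_def linear_add[OF assms(2)] linear_scale[OF assms(2)])
  show "alternating_on UNIV m (\<lambda>xs. g (f xs))"
    using vanish linear_0[OF assms(2)] by (simp add: alternating_on_def)
qed

context alternating_map begin

lemma in_subspace_of_generators:
  assumes T: "subspace T" and gen: "\<And>ys. length ys = m \<Longrightarrow> set ys \<subseteq> A \<Longrightarrow> f ys \<in> T"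
    and xs: "length xs = m" "set xs \<subseteq> span A"
  shows "f xs \<in> T"
proof -
  have "f (ps @ zs) \<in> T" if "length ps + length zs = m" "set ps \<subseteq> A" "set zs \<subseteq> span A" for ps zs
    using that
  proof (induction zs arbitrary: ps)
    case Nil
    then show ?case using gen[of ps] by simp
  next
    case (Cons z zs)
    have lin: "linear (\<lambda>x. f (ps @ x # zs))" using Cons.prems by (intro linear_slot) simp
    have "subspace ((\<lambda>x. f (ps @ x # zs)) -` T)" using linear_subspace_vimage[OF lin T] .
    moreover have "A \<subseteq> (\<lambda>x. f (ps @ x # zs)) -` T"
    proof
      fix x assume "x \<in> A"
      then have "f ((ps @ [x]) @ zs) \<in> T" using Cons.prems by (intro Cons.IH) auto
      then show "x \<in> (\<lambda>x. f (ps @ x # zs)) -` T" by simp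
    qed
    ultimately have "span A \<subseteq> (\<lambda>x. f (ps @ x # zs)) -` T" by (intro span_minimal)
    then show ?case using Cons.prems by auto
  qed
  from this[of "[]" xs] show ?thesis using xs by simp
qed

end

section \<open>Lorentzian metric Lie n-algebras\<close>

text \<open>The unique negative vector of an orthogonal basis serves as t. A vector orthogonal to it
  has no t-coordinate, so \<open>B y y\<close> is a sum of nonnegative terms, not all zero.\<close>

lemma lorentzian_timelike:
  assumes B: "euclidean_subspace {0} B" and L: "lorentzian_form_on UNIV B"
  obtains t where "B t t < 0" "\<And>y. B t y = 0 \<Longrightarrow> y \<noteq> 0 \<Longrightarrow> 0 < B y y"
proof -
  interpret euclidean_subspace "{0}" B by fact
  obtain E where E: "finite E" "span E = UNIV" "\<And>x y. x \<in> E \<Longrightarrow> y \<in> E \<Longrightarrow> x \<noteq> y \<Longrightarrow> B x y = 0"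
    "card {x \<in> E. B x x < 0} = 1" "\<And>x. x \<in> E \<Longrightarrow> B x x \<noteq> 0"
    using L unfolding lorentzian_form_on_def by auto
  obtain t where t: "{x \<in> E. B x x < 0} = {t}" using E(4) by (auto simp: card_1_singleton_iff)
  have tE: "t \<in> E" "B t t < 0" using t by auto
  have pos: "B x x > 0" if "x \<in> E" "x \<noteq> t" for x using that t E(5)[of x] by fastforce
  have lin: "linear (\<lambda>x. B x z)" for z by (auto intro!: linearI simp: B_simps)
  show ?thesis
  proof (rule that[OF tE(2)])
    fix y assume y: "B t y = 0" "y \<noteq> 0"
    have "y \<in> span E" using E(2) by simp
    then obtain f where f: "y = (\<Sum>x\<in>E. f x *\<^sub>R x)" using span_finite[OF E(1)] by auto
    have coord: "B y z = f z * B z z" if "z \<in> E" for z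
    proof -
      have "B y z = (\<Sum>x\<in>E. B (f x *\<^sub>R x) z)" unfolding f by (rule linear_sum[OF lin])
      also have "\<dots> = (\<Sum>x\<in>E. if x = z then f z * B z z else 0)"
        using E(3) that by (intro sum.cong) (auto simp: B_simps)
      finally show ?thesis using that E(1) by simp
    qed
    have ft: "f t = 0" using coord[OF tE(1)] y(1) tE B_sym by auto
    have "B y y = (\<Sum>x\<in>E. B (f x *\<^sub>R x) y)" by (subst (1) f) (rule linear_sum[OF lin])
    also have "\<dots> = (\<Sum>x\<in>E. (f x)\<^sup>2 * B x x)"
      using coord B_sym by (intro sum.cong) (auto simp: B_simps power2_eq_square)
    finally have Byy: "B y y = (\<Sum>x\<in>E. (f x)\<^sup>2 * B x x)" .
    have nn: "0 \<le> (f x)\<^sup>2 * B x x" if "x \<in> E" for x using ft pos[OF that] by (cases "x = t") auto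
    obtain x where x: "x \<in> E" "f x \<noteq> 0" using y(2) f by (metis (no_types, lifting) scale_eq_0_iff sum.neutral)
    then have "0 < (f x)\<^sup>2 * B x x" using ft pos[of x] by (cases "x = t") auto
    then show "0 < B y y" unfolding Byy using x E(1) nn by (intro sum_pos2[of E x]) auto
  qed
qed

text \<open>Subtracting a multiple of v from x reaches the spacelike hyperplane \<open>t\<^sup>\<bottom>\<close> without changing \<open>B x x\<close>.\<close>

lemma lorentzian_null_perp:
  assumes B: "euclidean_subspace {0} B" and L: "lorentzian_form_on UNIV B"
    and v: "v \<noteq> 0" "B v v = 0" "B x v = 0"
  shows "0 \<le> B x x" "B x x = 0 \<Longrightarrow> \<exists>c. x = c *\<^sub>R v"
proof -
  interpret euclidean_subspace "{0}" B by fact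
  obtain t where t: "B t t < 0" "\<And>y. B t y = 0 \<Longrightarrow> y \<noteq> 0 \<Longrightarrow> 0 < B y y"
    by (rule lorentzian_timelike[OF B L]) blast
  \<comment> \<open>Otherwise v would lie in the positive hyperplane, contrary to
    \<open>B v v = 0\<close>.\<close>
  have tv: "B t v \<noteq> 0" using t(2)[of v] v by auto
  define y where "y = x - (B t x / B t v) *\<^sub>R v"
  have ty: "B t y = 0" using tv by (simp add: y_def B_simps)
  have "B y y = B x x" using v B_sym[of v x] by (simp add: y_def B_simps)
  then show "0 \<le> B x x" "B x x = 0 \<Longrightarrow> \<exists>c. x = c *\<^sub>R v"
    using t(2)[OF ty] by (cases "y = 0"; force simp: B_simps y_def)+
qed

section \<open>Metric algebras and central null vectors\<close>

locale metric_lie_space =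
  fixes n :: nat and br :: "'v::euclidean_space list \<Rightarrow> 'v" and B :: "'v \<Rightarrow> 'v \<Rightarrow> real"
  assumes metric: "metric_lie_k UNIV n br B"
begin

sublocale br: alternating_map n br
  using metric by unfold_locales (auto simp: metric_lie_k_def lie_k_algebra_def)

sublocale euclidean_subspace "{0}" B
proof
  have sb: "sym_bilinear_on UNIV B" using metric by (simp add: metric_lie_k_def)
  show "B x y = B y x" for x y using sb by (simp add: sym_bilinear_on_def)
  have lin: "B (a *\<^sub>R x + b *\<^sub>R y) z = a * B x z + b * B y z" for a b x y z
    using sb unfolding sym_bilinear_on_def by blast
  show "B (x + y) z = B x z + B y z" for x y z using lin[of 1 x 1 y z] by simp
  show "B (r *\<^sub>R x) z = r * B x z" for r x z using lin[of r x 0 x z] by simp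
qed auto

lemma n2: "2 \<le> n" using metric by (simp add: metric_lie_k_def lie_k_algebra_def)

lemma skew: "length xs = n - 1 \<Longrightarrow> B (br (xs @ [y])) z = - B y (br (xs @ [z]))"
  using metric by (simp add: metric_lie_k_def)

lemma FI: "length xs = n - 1 \<Longrightarrow> length ys = n \<Longrightarrow>
    br (xs @ [br ys]) = (\<Sum>i<n. br (ys[i := br (xs @ [ys ! i])]))"
  using metric by (simp add: metric_lie_k_def lie_k_algebra_def)

lemma nondegenerate: "(\<And>y. B x y = 0) \<Longrightarrow> x = 0"
  using metric by (simp add: metric_lie_k_def nondegenerate_on_def)

definition F :: "'v list \<Rightarrow> real" where "F xs = B (br (butlast xs)) (last xs)"

lemma F_snoc: "F (xs @ [z]) = B (br xs) z" by (simp add: F_def)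

sublocale F: alternating_map "Suc n" F
proof
  show "multilinear_on UNIV (Suc n) F"
    unfolding multilinear_on_def
  proof (intro allI impI)
    fix xs :: "'v list" and i and x y :: 'v and a b :: real
    assume "length xs = Suc n \<and> set xs \<subseteq> UNIV \<and> i < Suc n \<and> x \<in> UNIV \<and> y \<in> UNIV"
    then have l: "length xs = Suc n" "xs \<noteq> []" "i < Suc n" by auto
    show "F (xs[i := a *\<^sub>R x + b *\<^sub>R y]) = a *\<^sub>R F (xs[i := x]) + b *\<^sub>R F (xs[i := y])"
    proof (cases "i = n")
      case True
      then show ?thesis using l by (simp add: F_def butlast_list_update last_list_update B_simps)
    next
      case False
      then show ?thesis
        using l br.multilin[unfolded multilinear_on_def, rule_format, of "butlast xs" i x y a b]
        by (simp add: F_def butlast_list_update last_list_update B_simps)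
    qed
  qed
  show "alternating_on UNIV (Suc n) F"
    unfolding alternating_on_def
  proof (intro allI impI)
    fix xs :: "'v list" assume a: "length xs = Suc n \<and> set xs \<subseteq> UNIV \<and> \<not> distinct xs"
    then obtain ys z where xs: "xs = ys @ [z]" by (metis append_butlast_last_id list.size(3) nat.distinct(1))
    have len: "length ys = n" using a xs by simp
    show "F xs = 0"
    proof (cases "distinct ys")
      case False
      then show ?thesis using br.vanish[OF len] by (simp add: xs F_snoc B_zero)
    next
      case True
      \<comment> \<open>The repeated z can be moved to the last place of the bracket, where
        skew-symmetry of \<open>ad\<close> gives zero.\<close>
      then have "z \<in> set ys" using a xs by auto
      then obtain zs where zs: "mset ys = mset (zs @ [z])" using mset_split_last by metis
      have "B (br (zs @ [z])) z = 0"
        using skew[of zs z z] mset_eq_length[OF zs] len B_sym[of z] by simp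
      then show ?thesis using br.permute[OF zs len] by (auto simp: xs F_snoc B_simps)
    qed
  qed
qed

lemma F_Cons: "xs \<noteq> [] \<Longrightarrow> F (u # xs) = B (br (u # butlast xs)) (last xs)" by (simp add: F_def)

text \<open>A radical vector v of I is null. By alternation of \<open>F\<close>, [v, ...] is again
  in the radical, so it is null and orthogonal to v, which in lorentzian signature makes it a
  multiple of v; skew-symmetry then removes the multiple.\<close>

lemma null_central:
  assumes L: "lorentzian_form_on UNIV B" and I: "ideal_of UNIV n br I" "\<not> nondegenerate_on I B"
  obtains v where "v \<noteq> 0" "B v v = 0" "\<And>ys. length ys = n - 1 \<Longrightarrow> br (v # ys) = 0"
proof -
  obtain v where v: "v \<in> I" "v \<noteq> 0" "\<And>y. y \<in> I \<Longrightarrow> B v y = 0"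
    using I(2) by (auto simp: nondegenerate_on_def)
  have Iid: "br (x # ys) \<in> I" if "x \<in> I" "length ys = n - 1" for x ys
    using I(1) that by (simp add: ideal_of_def)
  have multiple: "\<exists>c. br (v # ys) = c *\<^sub>R v" if ys: "length ys = n - 1" for ys
  proof -
    have rad: "B (br (v # ys)) y = 0" if y: "y \<in> I" for y
    proof -
      have "B (br (y # ys)) v = 0" using v(3)[OF Iid[OF y ys]] B_sym by simp
      then have "F ((y # ys) @ [v]) = 0" by (simp only: F_snoc)
      then have "F ((v # ys) @ [y]) = 0"
        using F.permute[of "(v # ys) @ [y]" "(y # ys) @ [v]"] ys n2 by simp
      then show ?thesis by (simp only: F_snoc)
    qed
    have "br (v # ys) \<in> I" using Iid v ys by simp
    then show ?thesis
      using lorentzian_null_perp(2)[OF euclidean_subspace_axioms L v(2) v(3)[OF v(1)] rad[OF v(1)]] rad by blast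
  qed
  obtain w where w: "B v w \<noteq> 0" using nondegenerate[of v] v(2) by auto
  have "br (v # ys) = 0" if ys: "length ys = n - 1" for ys
  proof -
    obtain zs y where zy: "ys = zs @ [y]" using ys n2 by (cases ys rule: rev_cases) auto
    obtain c where c: "br (v # ys) = c *\<^sub>R v" using multiple[OF ys] by blast
    obtain d where d: "br (v # zs @ [w]) = d *\<^sub>R v" using multiple[of "zs @ [w]"] ys zy by auto
    \<comment> \<open>If \<open>B v y\<close> is nonzero, alternation gives c = 0 at once; otherwise
      exchanging y and w gives \<open>c * B v w = 0\<close>, with w chosen not orthogonal to
      v.\<close>
    have "F (v # zs @ [y, y]) = 0" using ys zy by (intro F.vanish) auto
    then have cy: "c * B v y = 0" using F_snoc[of "v # ys" y] c zy by (simp add: B_simps)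
    have "F (v # zs @ [y, w]) = - F (v # zs @ [w, y])"
      using F.swap[of "v # zs" "[]" y w] ys zy n2 by simp
    then have "c * B v w = - (d * B v y)"
      using F_snoc[of "v # ys" w] F_snoc[of "v # zs @ [w]" y] c d zy by (simp add: B_simps)
    then have "c = 0" using cy w by auto
    then show ?thesis using c by simp
  qed
  then show ?thesis using that v by blast
qed

end

section \<open>The algebra over a central null vector v with dual null vector u\<close>

locale null_extension = metric_lie_space +
  fixes u v :: 'a
  assumes n4: "4 \<le> n"
    and uu: "B u u = 0" and vv: "B v v = 0" and uv: "B u v = 1"
    and v_central: "\<And>ys. length ys = n - 1 \<Longrightarrow> br (v # ys) = 0"
    and W_pos: "\<And>w. B u w = 0 \<Longrightarrow> B v w = 0 \<Longrightarrow> w \<noteq> 0 \<Longrightarrow> 0 < B w w"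
    and indecomposable: "\<And>I. ideal_of UNIV n br I \<Longrightarrow> nondegenerate_on I B \<Longrightarrow> I = {0} \<or> I = UNIV"
begin

definition W :: "'a set" where "W = {w. B u w = 0 \<and> B v w = 0}"

lemma vu: "B v u = 1" using uv B_sym by simp

lemma uv_nz: "u \<noteq> 0" "v \<noteq> 0" using uv by (auto simp: B_zero)

lemma W_euclidean: "euclidean_subspace W B"
  by unfold_locales (auto simp: W_def subspace_def B_simps B_sym intro: W_pos)

lemma decomposition: "x - B x v *\<^sub>R u - B x u *\<^sub>R v \<in> W"
  using B_sym by (auto simp: W_def B_simps uu vv uv vu)

lemma v_in_bracket: "length xs = n \<Longrightarrow> v \<in> set xs \<Longrightarrow> br xs = 0"
proof -
  assume xs: "length xs = n" "v \<in> set xs"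
  then obtain ps qs where "xs = ps @ v # qs" by (meson split_list)
  then have "mset xs = mset (v # ps @ qs)" "length (ps @ qs) = n - 1" using xs by auto
  then show ?thesis using br.permute[of xs "v # ps @ qs"] xs v_central by auto
qed

lemma bracket_shift:
  assumes "length ps + length qs + 1 = n"
  shows "br (ps @ (x - c *\<^sub>R v) # qs) = br (ps @ x # qs)"
  using assms v_in_bracket[of "ps @ v # qs"] by (simp add: br.slot_diff br.slot_scale)

lemma bracket_perp_v: "length xs = n \<Longrightarrow> B (br xs) v = 0"
proof -
  assume xs: "length xs = n"
  then have ne: "xs \<noteq> []" using n4 by auto
  have "F (v # xs) = 0" using xs v_central[of "butlast xs"] F_Cons[OF ne] by (simp add: B_zero)
  then have "F (xs @ [v]) = 0" using F.permute[of "xs @ [v]" "v # xs"] xs by simp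
  then show ?thesis by (simp add: F_snoc)
qed

text \<open>Brackets are orthogonal to v, hence have no u-component; removing the v-component
  projects them to W. This models the induced bracket on the complement of v modulo v.\<close>

definition brW :: "'a list \<Rightarrow> 'a" where "brW xs = br xs - B (br xs) u *\<^sub>R v"

lemma linear_proj: "linear (\<lambda>x. x - B x u *\<^sub>R v)"
  by (auto intro!: linearI simp: B_simps algebra_simps)

lemma brW_in_W: "length xs = n \<Longrightarrow> brW xs \<in> W"
  using bracket_perp_v[of xs] B_sym by (simp add: brW_def W_def B_simps uv vv)

lemma brW_update: 
  assumes "length xs = n" "i < n" shows "br (xs[i := brW ys]) = br (xs[i := br ys])"
  using assms bracket_shift[of "take i xs" "drop (Suc i) xs" "br ys"]
  by (simp add: upd_conv_take_nth_drop brW_def)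

text \<open>The discarded v-components are central and disappear inside a bracket, so the
  fundamental identity passes from \<open>br\<close> to the projection.\<close>

lemma brW_euclidean: "euclidean_lie_k W B n brW F"
proof -
  interpret W: euclidean_subspace W B by (rule W_euclidean)
  interpret brW: alternating_map n brW
    unfolding brW_def by (rule alternating_map_linear[OF br.alternating_map_axioms linear_proj])
  show ?thesis
  proof unfold_locales
    show "3 \<le> n" using n4 by simp
    show "brW xs \<in> W" if "length xs = n" for xs using brW_in_W[OF that] .
    show "F (xs @ [z]) = B (brW xs) z" if "z \<in> W" for xs z
      using that by (simp add: F_snoc brW_def B_simps W_def)
    fix xs ys :: "'a list" assume l: "length xs = n - 1" "length ys = n"
    have "br (xs @ [brW ys]) = br (xs @ [br ys])"
      using bracket_shift[of xs "[]"] l n4 by (simp add: brW_def)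
    then have "brW (xs @ [brW ys]) = brW (xs @ [br ys])" by (simp add: brW_def)
    also have "\<dots> = (\<Sum>i<n. brW (ys[i := br (xs @ [ys ! i])]))"
      unfolding brW_def FI[OF l] by (rule linear_sum[OF linear_proj])
    also have "\<dots> = (\<Sum>i<n. brW (ys[i := brW (xs @ [ys ! i])]))"
      using l by (intro sum.cong refl) (simp add: brW_def[of "list_update _ _ _"] brW_update)
    finally show "brW (xs @ [brW ys]) = (\<Sum>i<n. brW (ys[i := brW (xs @ [ys ! i])]))" .
  qed
qed

text \<open>A simple summand of the n-algebra on W lifts to \<open>[J, \<dots>, J]\<close> with \<open>J = S + \<real>v\<close>,
  which is a nondegenerate ideal of the whole algebra.\<close>

lemma brW_vanishes:
  assumes xs: "length xs = n" "set xs \<subseteq> W"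
  shows "brW xs = 0"
proof (rule ccontr)
  assume "brW xs \<noteq> 0"
  interpret W: euclidean_lie_k W B n brW F by (rule brW_euclidean)
  obtain s where s: "W.maximal_frame s" using W.maximal_frame_exists[OF xs \<open>brW xs \<noteq> 0\<close>] .
  have len: "length s = Suc n" and sW: "set s \<subseteq> W" using s by (auto simp: W.maximal_frame_def)
  have dist: "distinct s" by (rule W.frame_distinct[OF s])
  define J where "J = span (insert v (set s))"
  have J: "subspace J" by (simp add: J_def)
  have vJ: "v \<in> J" by (simp add: J_def span_base)
  have brJ: "br ys \<in> J" if "brW ys \<in> span (set s)" for ys
  proof -
    have "brW ys \<in> J" using that span_mono[of "set s" "insert v (set s)"] by (auto simp: J_def)
    then have "brW ys + B (br ys) u *\<^sub>R v \<in> J" using vJ J by (intro subspace_add subspace_scale)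
    then show ?thesis by (simp add: brW_def)
  qed
  have "\<forall>a\<in>set s. \<exists>ss. mset s = mset (ss @ [a])" using mset_split_last by metis
  then obtain ss where ss: "\<And>a. a \<in> set s \<Longrightarrow> mset s = mset (ss a @ [a])" by metis
  \<comment> \<open>\<open>l a\<close> lifts the frame vector a to the whole algebra: it is
    \<open>\<mu> a *\<^sub>R a\<close> plus a multiple of v (\<open>la\<close>).\<close>
  define l where "l a = br (ss a)" for a
  define \<mu> where "\<mu> a = F (ss a @ [a])" for a
  have \<mu>: "\<mu> a \<noteq> 0" if "a \<in> set s" for a
    using W.frame_perm_F[OF s ss[OF that]] s by (auto simp: \<mu>_def W.maximal_frame_def)
  have slen: "length (ss a) = n" if "a \<in> set s" for a using mset_eq_length[OF ss[OF that]] len by simp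
  have la: "l a = \<mu> a *\<^sub>R a + B (l a) u *\<^sub>R v" if "a \<in> set s" for a
    using W.frame_bracket[OF s ss[OF that]] by (simp add: l_def \<mu>_def brW_def algebra_simps)
  \<comment> \<open>J is stable under every \<open>ad\<close>: v is killed, and up to \<mu> and v
    each a is a bracket of frame vectors, so the fundamental identity reduces to
    \<open>frame_bracket_replace\<close>.\<close>
  have ad_J: "br (ys @ [y]) \<in> J" if ys: "length ys = n - 1" and y: "y \<in> J" for ys y
  proof -
    have lin: "linear (\<lambda>x. br (ys @ x # []))" using ys n4 by (intro br.linear_slot) simp
    have "subspace ((\<lambda>x. br (ys @ x # [])) -` J)" using linear_subspace_vimage[OF lin J] .
    moreover have "insert v (set s) \<subseteq> (\<lambda>x. br (ys @ x # [])) -` J"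
    proof
      fix a assume "a \<in> insert v (set s)"
      then consider "a = v" | "a \<in> set s" by auto
      then have "br (ys @ [a]) \<in> J"
      proof cases
        case 1
        then show ?thesis using v_in_bracket[of "ys @ [v]"] ys n4 J by (simp add: subspace_0)
      next
        case 2
        have "br (ys @ [l a]) = (\<Sum>i<n. br ((ss a)[i := br (ys @ [ss a ! i])]))"
          using FI[OF ys slen[OF 2]] by (simp add: l_def)
        also have "\<dots> \<in> J"
        proof (rule subspace_sum[OF J])
          fix i assume i: "i \<in> {..<n}"
          let ?d = "ys @ [ss a ! i]"
          have "brW ((ss a)[i := brW ?d]) \<in> span (set s)"
            using i ys n4 by (intro W.frame_bracket_replace[OF s ss[OF 2]] brW_in_W) auto
          then have "br ((ss a)[i := brW ?d]) \<in> J" by (rule brJ)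
          then show "br ((ss a)[i := br ?d]) \<in> J"
            using brW_update[of "ss a" i ?d] slen[OF 2] i by simp
        qed
        also have "br (ys @ [l a]) = \<mu> a *\<^sub>R br (ys @ [a])"
          using linear_add[OF lin] linear_scale[OF lin] v_in_bracket[of "ys @ [v]"] ys n4
          by (subst la[OF 2]) simp
        finally show ?thesis using subspace_scale[OF J, of "\<mu> a *\<^sub>R br (ys @ [a])" "1 / \<mu> a"] \<mu>[OF 2] by simp
      qed
      then show "a \<in> (\<lambda>x. br (ys @ x # [])) -` J" by simp
    qed
    ultimately have "J \<subseteq> (\<lambda>x. br (ys @ x # [])) -` J" unfolding J_def by (intro span_minimal)
    then show ?thesis using y by auto
  qed
  \<comment> \<open>J itself is degenerate, since v is orthogonal to all of it. A bracket of n
    distinct frame vectors omits exactly one a and equals \<open>l a\<close> up to sign, so I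
    contains all brackets of J.\<close>
  define I where "I = span (l ` set s)"
  have I: "subspace I" by (simp add: I_def)
  have br_I: "br zs \<in> I" if "length zs = n" "set zs \<subseteq> J" for zs
  proof (rule br.in_subspace_of_generators[OF I _ that(1)])
    show "set zs \<subseteq> span (insert v (set s))" using that by (simp add: J_def)
    fix ys assume ys: "length ys = n" "set ys \<subseteq> insert v (set s)"
    show "br ys \<in> I"
    proof (cases "v \<in> set ys \<or> \<not> distinct ys")
      case True
      then have "br ys = 0" using v_in_bracket br.vanish ys by auto
      then show ?thesis using I by (simp add: subspace_0)
    next
      case False
      then have ys': "set ys \<subseteq> set s" "distinct ys" using ys by auto
      have "card (set s - set ys) = 1"
        using ys' ys(1) len dist by (simp add: card_Diff_subset distinct_card)
      then obtain a where a: "set s - set ys = {a}" by (auto simp: card_1_singleton_iff)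
      have as: "a \<in> set s" using a by auto
      have "set s = set (ys @ [a])" "distinct (ys @ [a])" using a ys' by auto
      then have "mset s = mset (ys @ [a])" using dist set_eq_iff_mset_eq_distinct by blast
      then have "mset ys = mset (ss a)" using ss[OF as] by simp
      then have "br ys = l a \<or> br ys = - l a" using br.permute[of ys "ss a"] ys by (simp add: l_def)
      moreover have "l a \<in> I" using as by (simp add: I_def span_base)
      ultimately show ?thesis using subspace_neg[OF I] by auto
    qed
  qed
  have ideal: "ideal_of UNIV n br I"
    unfolding ideal_of_def
  proof (intro conjI ballI allI impI I)
    fix x and ys :: "'a list" assume x: "x \<in> I" and "length ys = n - 1 \<and> set ys \<subseteq> UNIV"
    then have ys: "length ys = n - 1" by simp
    have lin: "linear (\<lambda>x. br (ys @ x # []))" using ys n4 by (intro br.linear_slot) simp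
    have "subspace ((\<lambda>x. br (ys @ x # [])) -` I)" using linear_subspace_vimage[OF lin I] .
    moreover have "l ` set s \<subseteq> (\<lambda>x. br (ys @ x # [])) -` I"
    proof (rule image_subsetI)
      fix a assume a: "a \<in> set s"
      have sJ: "set (ss a) \<subseteq> J"
        using mset_eq_setD[OF ss[OF a]] by (auto simp: J_def span_base)
      \<comment> \<open>The fundamental identity moves \<open>ad\<close> into the entries of
        \<open>l a\<close>; they stay in J by \<open>ad_J\<close>, so each summand is a bracket of
        J.\<close>
      have "br (ys @ [l a]) = (\<Sum>i<n. br ((ss a)[i := br (ys @ [ss a ! i])]))"
        using FI[OF ys slen[OF a]] by (simp add: l_def)
      also have "\<dots> \<in> I"
      proof (rule subspace_sum[OF I])
        fix i assume i: "i \<in> {..<n}"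
        have "br (ys @ [ss a ! i]) \<in> J" using sJ i slen[OF a] by (intro ad_J[OF ys]) auto
        then show "br ((ss a)[i := br (ys @ [ss a ! i])]) \<in> I"
          using sJ slen[OF a] by (intro br_I) (auto dest!: subsetD[OF set_update_subset_insert])
      qed
      finally show "l a \<in> (\<lambda>x. br (ys @ x # [])) -` I" by simp
    qed
    ultimately have "I \<subseteq> (\<lambda>x. br (ys @ x # [])) -` I" unfolding I_def by (intro span_minimal)
    then have "br (ys @ [x]) \<in> I" using x by auto
    moreover have "br (x # ys) = br (ys @ [x]) \<or> br (x # ys) = - br (ys @ [x])"
      using ys n4 by (intro br.permute) auto
    ultimately show "br (x # ys) \<in> I" using subspace_neg[OF I] by auto
  qed auto
  have sv: "B a v = 0" if "a \<in> set s" for a using that sW B_sym by (auto simp: W_def)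
  \<comment> \<open>The v-parts are null and orthogonal to W, so the lifts stay orthogonal with
    positive squares; hence I is nondegenerate.\<close>
  have ll: "B (l a) (l b) = (if a = b then (\<mu> a)\<^sup>2 else 0)" if "a \<in> set s" "b \<in> set s" for a b
    using W.frame_orthonormal[OF s that] sv[OF that(1)] sv[OF that(2)] B_sym[of v b]
    by (subst la[OF that(1)], subst la[OF that(2)]) (auto simp: B_simps vv power2_eq_square)
  have "nondegenerate_on I B"
    unfolding nondegenerate_on_def
  proof (intro ballI impI)
    fix x assume "x \<in> I" and x0: "\<forall>y\<in>I. B x y = 0"
    then have "x \<in> span (l ` set s)" by (simp add: I_def)
    then obtain f where f: "x = (\<Sum>y\<in>l ` set s. f y *\<^sub>R y)" using span_finite[of "l ` set s"] by auto
    have lin: "linear (\<lambda>x. B x z)" for z by (auto intro!: linearI simp: B_simps)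
    have "f z = 0" if z: "z \<in> l ` set s" for z
    proof -
      obtain b where b: "b \<in> set s" "z = l b" using z by auto
      have "B x z = (\<Sum>y\<in>l ` set s. B (f y *\<^sub>R y) z)" unfolding f by (rule linear_sum[OF lin])
      also have "\<dots> = (\<Sum>y\<in>l ` set s. if y = z then f z * B z z else 0)"
      proof (intro sum.cong refl)
        fix y assume "y \<in> l ` set s"
        then obtain a where a: "a \<in> set s" "y = l a" by auto
        then show "B (f y *\<^sub>R y) z = (if y = z then f z * B z z else 0)"
          using ll[OF a(1) b(1)] b(2) by (auto simp: B_simps)
      qed
      also have "\<dots> = f z * B z z" using z by simp
      finally have "f z * B z z = 0" using x0 z by (simp add: I_def span_base)
      then show ?thesis using ll[OF b(1) b(1)] \<mu>[OF b(1)] b(2) by simp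
    qed
    then show "x = 0" using f by simp
  qed
  then have "I = {0} \<or> I = UNIV" using indecomposable ideal by blast
  moreover have "I \<noteq> {0}"
  proof -
    obtain a where a: "a \<in> set s" using len by (cases s) auto
    then have "l a \<noteq> 0" using ll[OF a a] \<mu> by (auto simp: B_zero)
    then show ?thesis using a span_base[of "l a" "l ` set s"] by (auto simp: I_def)
  qed
  moreover have "I \<noteq> UNIV"
  proof
    assume "I = UNIV"
    then have "u \<in> span (l ` set s)" by (simp add: I_def)
    then have "B u v = 0"
      by (rule span_orthogonal) (use bracket_perp_v slen in \<open>auto simp: l_def\<close>)
    then show False using uv by simp
  qed
  ultimately show False by blast
qed

definition br' :: "'a list \<Rightarrow> 'a" where "br' xs = br (u # xs)"

text \<open>Since \<open>brW\<close> vanishes on W, only a v-component is left; its coefficient is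
  \<open>F (xs @ [u])\<close>, and moving u to the front past n entries gives the sign.\<close>

lemma br_W: 
  assumes "length xs = n" "set xs \<subseteq> W"
  shows "br xs = ((-1) ^ n * B (br' (butlast xs)) (last xs)) *\<^sub>R v"
proof -
  have ne: "xs \<noteq> []" using assms n4 by auto
  have "br xs = B (br xs) u *\<^sub>R v" using brW_vanishes[OF assms] by (simp add: brW_def)
  also have "B (br xs) u = F (xs @ [u])" by (simp add: F_snoc)
  also have "\<dots> = (-1) ^ n * F (u # xs)" using F.move[of "[]" xs "[]" u] assms by simp
  also have "F (u # xs) = B (br' (butlast xs)) (last xs)" using F_Cons[OF ne] by (simp add: br'_def)
  finally show ?thesis .
qed

lemma br'_in_W: "length xs = n - 1 \<Longrightarrow> br' xs \<in> W"
proof -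
  assume xs: "length xs = n - 1"
  have "F ((u # xs) @ [u]) = 0" using xs n4 by (intro F.vanish) auto
  then have "B (br' xs) u = 0" by (simp only: F_snoc br'_def)
  moreover have "B (br' xs) v = 0" using xs n4 by (simp add: br'_def bracket_perp_v)
  ultimately show ?thesis using B_sym by (simp add: W_def)
qed

lemma br'_alternating: "alternating_map (n - 1) br'"
  unfolding br'_def using n4 br.alternating_map_axioms by (intro alternating_map_Cons) simp

text \<open>The fundamental identity of \<open>br\<close> with u frozen in both brackets; the term
  where \<open>ad\<close> hits u vanishes because u occurs twice.\<close>

lemma br'_FI:
  assumes l: "length xs = n - 1 - 1" "length ys = n - 1"
  shows "br' (xs @ [br' ys]) = (\<Sum>i<n-1. br' (ys[i := br' (xs @ [ys ! i])]))"
proof -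
  have n: "n = Suc (n - 1)" using n4 by simp
  have "br ((u # xs) @ [br (u # ys)]) = (\<Sum>i<n. br ((u # ys)[i := br ((u # xs) @ [(u # ys) ! i])]))"
    using l n4 by (intro FI) auto
  also have "\<dots> = br (br ((u # xs) @ [u]) # ys) + (\<Sum>i<n-1. br' (ys[i := br' (xs @ [ys ! i])]))"
    by (subst n, subst sum.lessThan_Suc_shift) (simp add: br'_def)
  also have "br ((u # xs) @ [u]) = 0" using l n4 by (intro br.vanish) auto
  also have "br (0 # ys) = 0" using br.slot_0[of "[]" ys] l n4 by simp
  finally show ?thesis by (simp add: br'_def)
qed

lemma br'_euclidean: "euclidean_lie_k W B (n - 1) br' (\<lambda>xs. F (u # xs))"
proof -
  interpret W: euclidean_subspace W B by (rule W_euclidean)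
  interpret br': alternating_map "n - 1" br' by (rule br'_alternating)
  interpret F': alternating_map "Suc (n - 1)" "\<lambda>xs. F (u # xs)"
    using n4 F.alternating_map_axioms by (intro alternating_map_Cons) simp
  show ?thesis
  proof unfold_locales
    show "3 \<le> n - 1" using n4 by simp
    show "br' xs \<in> W" if "length xs = n - 1" for xs using br'_in_W[OF that] .
    show "F (u # xs @ [z]) = B (br' xs) z" for xs z using F_snoc[of "u # xs" z] by (simp add: br'_def)
    show "br' (xs @ [br' ys]) = (\<Sum>i<n-1. br' (ys[i := br' (xs @ [ys ! i])]))"
      if "length xs = n - 1 - 1" "length ys = n - 1" for xs ys using br'_FI[OF that] .
  qed
qed

section \<open>Absence of a center and the dimension count\<close>

lemma span_uvW: "span (insert u (insert v W)) = UNIV"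
proof -
  have "x \<in> span (insert u (insert v W))" for x
  proof -
    have "B x v *\<^sub>R u + B x u *\<^sub>R v + (x - B x v *\<^sub>R u - B x u *\<^sub>R v) \<in> span (insert u (insert v W))"
      using decomposition[of x] by (intro span_add span_scale span_base) auto
    then show ?thesis by simp
  qed
  then show ?thesis by auto
qed

text \<open>A line of central vectors is an ideal, and a nonnull one is nondegenerate, so
  indecomposability leaves only the whole space.\<close>

lemma central_line_nondegenerate:
  assumes c: "\<And>ys. length ys = n - 1 \<Longrightarrow> br (x # ys) = 0" and x: "B x x \<noteq> 0"
  shows "span {x} = UNIV"
proof -
  have "ideal_of UNIV n br (span {x})"
    unfolding ideal_of_def
  proof (intro conjI ballI allI impI)
    fix y and ys :: "'a list" assume "y \<in> span {x}" "length ys = n - 1 \<and> set ys \<subseteq> UNIV"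
    then obtain r where "y = r *\<^sub>R x" "length ys = n - 1" by (auto simp: span_singleton)
    then have "br (y # ys) = 0" using br.slot_scale[of "[]" ys r x] c n4 by simp
    then show "br (y # ys) \<in> span {x}" by (simp add: span_0)
  qed auto
  moreover have "nondegenerate_on (span {x}) B"
    unfolding nondegenerate_on_def
  proof (intro ballI impI)
    fix y assume y: "y \<in> span {x}" "\<forall>z\<in>span {x}. B y z = 0"
    then obtain r where r: "y = r *\<^sub>R x" by (auto simp: span_singleton)
    have "B y x = 0" using y(2) by (simp add: span_base)
    then show "y = 0" using r x by (simp add: B_simps)
  qed
  ultimately have "span {x} = {0} \<or> span {x} = UNIV" by (rule indecomposable)
  moreover have "x \<noteq> 0" using x by (auto simp: B_zero)
  ultimately show ?thesis using span_base[of x "{x}"] by auto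
qed

lemma span_line_neq_UNIV: "B x x \<noteq> 0 \<Longrightarrow> span {x} \<noteq> UNIV"
proof
  assume x: "B x x \<noteq> 0" "span {x} = UNIV"
  then have "v \<in> span {x}" by simp
  then obtain r where "v = r *\<^sub>R x" by (auto simp: span_singleton)
  then show False using vv uv_nz x(1) by (auto simp: B_simps)
qed

text \<open>A vector of W central for \<open>br'\<close> is central in the whole algebra: an entry v
  or a repeated entry gives zero, a single u gives \<open>br'\<close>, and entries in W reduce to
  \<open>br'\<close> by \<open>br_W\<close>. If nonzero it has positive square, so
  \<open>central_line_nondegenerate\<close> applies.\<close>

lemma br'_centerless:
  assumes x: "x \<in> W" and c: "\<And>ys. length ys = n - 1 - 1 \<Longrightarrow> set ys \<subseteq> W \<Longrightarrow> br' (x # ys) = 0"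
  shows "x = 0"
proof (rule ccontr)
  assume "x \<noteq> 0"
  then have Bx: "B x x \<noteq> 0" using W_pos[of x] x by (auto simp: W_def)
  interpret brx: alternating_map "n - 1" "\<lambda>ys. br (x # ys)"
    using n4 br.alternating_map_axioms by (intro alternating_map_Cons) simp
  have "br (x # ys) \<in> {0}" if ys: "length ys = n - 1" for ys
  proof (rule brx.in_subspace_of_generators[OF _ _ ys])
    show "set ys \<subseteq> span (insert u (insert v W))" by (simp add: span_uvW)
    fix zs assume zs: "length zs = n - 1" "set zs \<subseteq> insert u (insert v W)"
    have len: "length (x # zs) = n" using zs n4 by simp
    consider "v \<in> set zs" | "\<not> distinct zs" | "v \<notin> set zs" "distinct zs" "u \<in> set zs" | "set zs \<subseteq> W"
      using zs by auto
    then show "br (x # zs) \<in> {0}"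
    proof cases
      case 1
      then show ?thesis using v_in_bracket[OF len] by simp
    next
      case 2
      then show ?thesis using br.vanish[OF len] by simp
    next
      case 3
      obtain ps qs where pq: "zs = ps @ u # qs" using 3(3) by (meson split_list)
      have "set (ps @ qs) \<subseteq> W" using 3 zs pq by auto
      then have "br (u # x # ps @ qs) = 0" using c[of "ps @ qs"] zs pq by (simp add: br'_def)
      then show ?thesis using br.permute[OF _ len, of "u # x # ps @ qs"] pq by simp
    next
      case 4
      have "zs \<noteq> []" using zs n4 by auto
      then have "br' (butlast (x # zs)) = 0"
        using c[of "butlast zs"] zs 4 by (auto dest: in_set_butlastD)
      then show ?thesis using br_W[OF len] 4 x by (simp add: B_zero)
    qed
  qed (auto simp: subspace_def)
  then have "span {x} = UNIV" using central_line_nondegenerate[OF _ Bx] by simp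
  then show False using span_line_neq_UNIV[OF Bx] by simp
qed

text \<open>Otherwise u is central as well, and u + v is a central vector of square 2. This is what
  excludes m = 0.\<close>

lemma W_nontrivial: "W \<noteq> {0}"
proof
  assume W0: "W = {0}"
  have B2: "B (u + v) (u + v) \<noteq> 0" by (simp add: B_simps uu vv uv vu)
  have "br ((u + v) # ys) = 0" if "length ys = n - 1" for ys
  proof -
    have "br (u # ys) = 0" using br'_in_W[OF that] W0 by (simp add: br'_def)
    then show ?thesis using br.slot_add[of "[]" ys u v] that n4 v_central by simp
  qed
  from central_line_nondegenerate[OF this B2] span_line_neq_UNIV[OF B2] show False by simp
qed

lemma dim_UNIV_eq:
  assumes "independent E" "span E = W" "finite E"
  shows "dim (UNIV :: 'a set) = card E + 2"
proof -
  have v: "v \<notin> span E" using assms uv by (auto simp: W_def)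
  then have ind: "independent (insert v E)" using assms by (intro independent_insertI)
  have u: "u \<notin> span (insert v E)"
  proof
    assume "u \<in> span (insert v E)"
    moreover have "B a v = 0" if "a \<in> insert v E" for a
      using that assms(2) span_base[of a E] vv B_sym by (auto simp: W_def)
    ultimately have "B u v = 0" by (rule span_orthogonal)
    then show False using uv by simp
  qed
  then have ind2: "independent (insert u (insert v E))" using ind by (rule independent_insertI)
  have "W \<subseteq> span (insert u (insert v E))" using assms(2) span_mono[of E "insert u (insert v E)"] by auto
  then have "span (insert u (insert v W)) \<subseteq> span (insert u (insert v E))"
    by (intro span_minimal) (auto intro: span_base)
  then have "span (insert u (insert v E)) = UNIV" using span_uvW by auto
  then have "dim (UNIV :: 'a set) = card (insert u (insert v E))"
    using dim_eq_card[of "insert u (insert v E)" UNIV] ind2 by simp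
  moreover have "u \<notin> insert v E" "v \<notin> E" using u v span_base by blast+
  ultimately show ?thesis using assms(3) by simp
qed

lemma br'_iso_sum_simple:
  "\<exists>m\<ge>1. iso_sum_simple W (n - 1) br' B m \<and> dim (UNIV :: 'a set) = m * n + 2"
proof -
  obtain m where m: "iso_sum_simple W (n - 1) br' B m"
    using centerless_iso_sum_simple[OF br'_euclidean br'_centerless] by blast
  then obtain e c where e: "inj_on (\<lambda>(j, i). e j i) ({..<m} \<times> {1..n - 1 + 1})"
    "independent ((\<lambda>(j, i). e j i) ` ({..<m} \<times> {1..n - 1 + 1}))"
    "span ((\<lambda>(j, i). e j i) ` ({..<m} \<times> {1..n - 1 + 1})) = W"
    unfolding iso_sum_simple_def Let_def by (elim exE conjE) (rule that)
  have "m \<noteq> 0" using W_nontrivial e(3) by (intro notI) simp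
  then have "m \<ge> 1" by simp
  \<comment> \<open>Each block is a copy of the model of arity n - 1 and has n - 1 + 1 = n
    vectors.\<close>
  have "card ((\<lambda>(j, i). e j i) ` ({..<m} \<times> {1..n - 1 + 1})) = m * n"
    using card_image[OF e(1)] n4 by simp
  then have "dim (UNIV :: 'a set) = m * n + 2" using dim_UNIV_eq[OF e(2,3)] by simp
  with m \<open>m \<ge> 1\<close> show ?thesis by blast
qed

lemma normal_form:
  "\<exists>u v W. subspace W \<and>
      B u u = 0 \<and> B v v = 0 \<and> B u v = 1 \<and>
      (\<forall>w\<in>W. B u w = 0 \<and> B v w = 0) \<and>
      euclidean_form_on W B \<and>
      (\<forall>x. \<exists>!(a, b, w). w \<in> W \<and> x = a *\<^sub>R u + b *\<^sub>R v + w) \<and>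
      (\<exists>br'. closed_on W (n - 1) br' \<and> multilinear_on W (n - 1) br' \<and>
             alternating_on W (n - 1) br' \<and>
         (\<forall>xs. length xs = n - 1 \<and> set xs \<subseteq> W \<longrightarrow> br (u # xs) = br' xs) \<and>
         (\<forall>xs. length xs = n \<and> set xs \<subseteq> W \<longrightarrow>
            br xs = ((-1) ^ n * B (br' (butlast xs)) (last xs)) *\<^sub>R v) \<and>
         (\<forall>ys. length ys = n - 1 \<longrightarrow> br (v # ys) = 0) \<and>
         metric_lie_k W (n - 1) br' B \<and> euclidean_form_on W B \<and>
         (\<exists>m\<ge>1. iso_sum_simple W (n - 1) br' B m \<and>
                 dim (UNIV :: 'a set) = m * n + 2))"
proof (rule exI[of _ u], rule exI[of _ v], rule exI[of _ W], intro conjI exI[of _ br'])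
  interpret W: euclidean_lie_k W B "n - 1" br' "\<lambda>xs. F (u # xs)" by (rule br'_euclidean)
  show "subspace W" by (rule W.sub)
  show "B u u = 0" "B v v = 0" "B u v = 1" by (rule uu vv uv)+
  show "\<forall>w\<in>W. B u w = 0 \<and> B v w = 0" by (auto simp: W_def)
  show ef: "euclidean_form_on W B" "euclidean_form_on W B" using W.B_pos by (auto simp: euclidean_form_on_def)
  show "\<forall>x. \<exists>!(a, b, w). w \<in> W \<and> x = a *\<^sub>R u + b *\<^sub>R v + w"
  proof
    fix x
    show "\<exists>!(a, b, w). w \<in> W \<and> x = a *\<^sub>R u + b *\<^sub>R v + w"
    proof (rule ex1I[of _ "(B x v, B x u, x - B x v *\<^sub>R u - B x u *\<^sub>R v)"])
      show "case (B x v, B x u, x - B x v *\<^sub>R u - B x u *\<^sub>R v) of (a, b, w) \<Rightarrow> w \<in> W \<and> x = a *\<^sub>R u + b *\<^sub>R v + w"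
        using decomposition by simp
      fix y assume "case y of (a, b, w) \<Rightarrow> w \<in> W \<and> x = a *\<^sub>R u + b *\<^sub>R v + w"
      then obtain a b w where y: "y = (a, b, w)" "w \<in> W" "x = a *\<^sub>R u + b *\<^sub>R v + w" by (cases y) auto
      then have "B w u = 0" "B w v = 0" using B_sym by (auto simp: W_def)
      then have "B x v = a" "B x u = b" using y(3) by (simp_all add: B_simps uu vv uv vu)
      then show "y = (B x v, B x u, x - B x v *\<^sub>R u - B x u *\<^sub>R v)" using y by simp
    qed
  qed
  show cl: "closed_on W (n - 1) br'" using br'_in_W by (simp add: closed_on_def)
  show ml: "multilinear_on W (n - 1) br'" using W.br.multilin by (simp add: multilinear_on_def)
  show al: "alternating_on W (n - 1) br'" using W.br.alternating by (simp add: alternating_on_def)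
  show "\<forall>xs. length xs = n - 1 \<and> set xs \<subseteq> W \<longrightarrow> br (u # xs) = br' xs" by (simp add: br'_def)
  show "\<forall>xs. length xs = n \<and> set xs \<subseteq> W \<longrightarrow> br xs = ((-1) ^ n * B (br' (butlast xs)) (last xs)) *\<^sub>R v"
    using br_W by blast
  show "\<forall>ys. length ys = n - 1 \<longrightarrow> br (v # ys) = 0" using v_central by blast
  show "metric_lie_k W (n - 1) br' B"
    unfolding metric_lie_k_def
  proof (intro conjI allI impI)
    show "lie_k_algebra W (n - 1) br'"
      unfolding lie_k_algebra_def using W.sub cl ml al n4 W.br_FI by auto
    show "sym_bilinear_on W B" using B_sym by (auto simp: sym_bilinear_on_def B_simps)
    show "nondegenerate_on W B" using W.B_eq_0_iff by (auto simp: nondegenerate_on_def)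
    fix xs y z assume "length xs = n - 1 - 1 \<and> set xs \<subseteq> W \<and> y \<in> W \<and> z \<in> W"
    then show "B (br' (xs @ [y])) z = - B y (br' (xs @ [z]))"
      using skew[of "u # xs" y z] n4 by (simp add: br'_def)
  qed
  show "\<exists>m\<ge>1. iso_sum_simple W (n - 1) br' B m \<and> dim (UNIV :: 'a set) = m * n + 2"
    by (rule br'_iso_sum_simple)
qed

end

section \<open>The trichotomy for indecomposable lorentzian algebras\<close>

theorem theorem3p1:
  fixes n :: nat
    and br :: "'v::euclidean_space list \<Rightarrow> 'v"
    and B :: "'v \<Rightarrow> 'v \<Rightarrow> real"
  assumes "4 \<le> n"
    and "indecomposable_metric UNIV n br B"
    and "lorentzian_form_on UNIV B"
  shows "let
      P1 = (dim (UNIV :: 'v set) = 1);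
      P2 = simple_lie_k UNIV n br;
      P3 = (\<exists>u v W. subspace W \<and>
              B u u = 0 \<and> B v v = 0 \<and> B u v = 1 \<and>
              (\<forall>w\<in>W. B u w = 0 \<and> B v w = 0) \<and>
              euclidean_form_on W B \<and>
              (\<forall>x. \<exists>!(a, b, w). w \<in> W \<and> x = a *\<^sub>R u + b *\<^sub>R v + w) \<and>
              (\<exists>br'. closed_on W (n - 1) br' \<and> multilinear_on W (n - 1) br' \<and>
                     alternating_on W (n - 1) br' \<and>
                 (\<forall>xs. length xs = n - 1 \<and> set xs \<subseteq> W \<longrightarrow> br (u # xs) = br' xs) \<and>
                 (\<forall>xs. length xs = n \<and> set xs \<subseteq> W \<longrightarrow>
                    br xs = ((-1) ^ n * B (br' (butlast xs)) (last xs)) *\<^sub>R v) \<and>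
                 (\<forall>ys. length ys = n - 1 \<longrightarrow> br (v # ys) = 0) \<and>
                 metric_lie_k W (n - 1) br' B \<and> euclidean_form_on W B \<and>
                 (\<exists>m\<ge>1. iso_sum_simple W (n - 1) br' B m \<and>
                         dim (UNIV :: 'v set) = m * n + 2)))
    in (P1 \<or> P2 \<or> P3) \<and> \<not> (P1 \<and> P2) \<and> \<not> (P1 \<and> P3) \<and> \<not> (P2 \<and> P3)"
proof -
  define P3 where "P3 \<longleftrightarrow> (\<exists>u v W. subspace W \<and>
              B u u = 0 \<and> B v v = 0 \<and> B u v = 1 \<and>
              (\<forall>w\<in>W. B u w = 0 \<and> B v w = 0) \<and>
              euclidean_form_on W B \<and>
              (\<forall>x. \<exists>!(a, b, w). w \<in> W \<and> x = a *\<^sub>R u + b *\<^sub>R v + w) \<and>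
              (\<exists>br'. closed_on W (n - 1) br' \<and> multilinear_on W (n - 1) br' \<and>
                     alternating_on W (n - 1) br' \<and>
                 (\<forall>xs. length xs = n - 1 \<and> set xs \<subseteq> W \<longrightarrow> br (u # xs) = br' xs) \<and>
                 (\<forall>xs. length xs = n \<and> set xs \<subseteq> W \<longrightarrow>
                    br xs = ((-1) ^ n * B (br' (butlast xs)) (last xs)) *\<^sub>R v) \<and>
                 (\<forall>ys. length ys = n - 1 \<longrightarrow> br (v # ys) = 0) \<and>
                 metric_lie_k W (n - 1) br' B \<and> euclidean_form_on W B \<and>
                 (\<exists>m\<ge>1. iso_sum_simple W (n - 1) br' B m \<and>
                         dim (UNIV :: 'v set) = m * n + 2)))"
  have metric: "metric_lie_k UNIV n br B"
    and ind: "\<And>I. ideal_of UNIV n br I \<Longrightarrow> nondegenerate_on I B \<Longrightarrow> I = {0} \<or> I = UNIV"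
    using assms(2) by (auto simp: indecomposable_metric_def)
  interpret metric_lie_space n br B by unfold_locales (rule metric)
  have P3I: P3 if nP: "dim (UNIV :: 'v set) \<noteq> 1" "\<not> simple_lie_k UNIV n br"
  proof -
    have "lie_k_algebra UNIV n br" using metric by (simp add: metric_lie_k_def)
    then obtain I where I: "ideal_of UNIV n br I" "I \<noteq> {0}" "I \<noteq> UNIV"
      using nP by (auto simp: simple_lie_k_def)
    then have "\<not> nondegenerate_on I B" using ind by blast
    with I(1) obtain v where v: "v \<noteq> 0" "B v v = 0" "\<And>ys. length ys = n - 1 \<Longrightarrow> br (v # ys) = 0"
      using null_central[OF assms(3)] by blast
    obtain w where w: "B v w \<noteq> 0" using nondegenerate[of v] v(1) by auto
    \<comment> \<open>w' has pairing 1 with v; subtracting half its square times v makes u null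
      without changing that pairing.\<close>
    define w' where "w' = (1 / B v w) *\<^sub>R w"
    have w': "B v w' = 1" "B w' v = 1" using w B_sym[of w v] by (auto simp: w'_def B_simps)
    define u where "u = w' - (B w' w' / 2) *\<^sub>R v"
    have u: "B u u = 0" "B u v = 1" using w' v(2) by (auto simp: u_def B_simps)
    interpret null_extension n br B u v
    proof
      fix x assume x: "B u x = 0" "B v x = 0" "x \<noteq> 0"
      have xv: "B x v = 0" using x B_sym by simp
      note np = lorentzian_null_perp[OF euclidean_subspace_axioms assms(3) v(1,2) xv]
      \<comment> \<open>A null x orthogonal to v is \<open>c *\<^sub>R v\<close>, and pairing with u
        gives c = 0.\<close>
      have "B x x \<noteq> 0"
      proof
        assume "B x x = 0"
        then obtain c where "x = c *\<^sub>R v" using np(2) by blast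
        then show False using x u by (auto simp: B_simps)
      qed
      then show "0 < B x x" using np(1) by simp
    qed (use assms(1) u v ind in auto)
    show P3 unfolding P3_def by (rule normal_form)
  qed
  have P3D: "dim (UNIV :: 'v set) \<noteq> 1 \<and> \<not> simple_lie_k UNIV n br" if P3
  proof -
    obtain u v m where uv: "B v v = 0" "B u v = 1" "\<And>ys. length ys = n - 1 \<Longrightarrow> br (v # ys) = 0"
      and m: "dim (UNIV :: 'v set) = m * n + 2"
      using \<open>P3\<close> unfolding P3_def by blast
    have "v \<noteq> 0" using uv(2) by (auto simp: B_zero)
    \<comment> \<open>The line of v is a nonzero proper ideal, so the algebra is not simple; the
      value \<open>m * n + 2\<close> excludes dimension 1.\<close>
    have "ideal_of UNIV n br (span {v})"
      unfolding ideal_of_def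
    proof (intro conjI ballI allI impI)
      fix y and ys :: "'v list" assume "y \<in> span {v}" "length ys = n - 1 \<and> set ys \<subseteq> UNIV"
      then obtain r where "y = r *\<^sub>R v" "length ys = n - 1" by (auto simp: span_singleton)
      then have "br (y # ys) = 0" using br.slot_scale[of "[]" ys r v] uv(3) n2 by simp
      then show "br (y # ys) \<in> span {v}" by (simp add: span_0)
    qed auto
    moreover have "span {v} \<noteq> {0}" using \<open>v \<noteq> 0\<close> span_base[of v "{v}"] by auto
    moreover have "span {v} \<noteq> UNIV"
    proof
      assume "span {v} = UNIV"
      then have "u \<in> span {v}" by simp
      then obtain r where "u = r *\<^sub>R v" by (auto simp: span_singleton)
      then show False using uv by (simp add: B_simps)
    qed
    ultimately show ?thesis using m by (auto simp: simple_lie_k_def)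
  qed
  have "\<not> (dim (UNIV :: 'v set) = 1 \<and> simple_lie_k UNIV n br)" by (simp add: simple_lie_k_def)
  then have "(dim (UNIV :: 'v set) = 1 \<or> simple_lie_k UNIV n br \<or> P3) \<and>
    \<not> (dim (UNIV :: 'v set) = 1 \<and> simple_lie_k UNIV n br) \<and>
    \<not> (dim (UNIV :: 'v set) = 1 \<and> P3) \<and> \<not> (simple_lie_k UNIV n br \<and> P3)"
    using P3I P3D by blast
  then show ?thesis unfolding Let_def P3_def .
qed

end
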